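(* For all integers $k \ge 3$ and $\ell \ge 2$ there exists a connected plane graph $G$ with exactly $f := 2k(\ell-1)+2$ faces such that $$\mathfrak{c}(G;f) = \frac{\ell(\ell+1)}{2} \quad\text{and}\quad \dot{\mathfrak{c}}(G;f) = 1.$$ Furthermore, such a graph $G$ can be chosen to be $3$-connected when $k=3$ and $\ell \ge 3$, and $4$-connected otherwise.
   Context: A cycle is a connected $2$-regular graph. A cycle double cover (CDC) of a graph $G$ is a multiset of cycles of $G$ such that every edge of $G$ lies in exactly two members, counted with multiplicity; its size is the number of cycles counted with multiplicity. A CDC is true if no cycle appears in it twice. $\mathfrak{c}(G;k)$ denotes the number of distinct CDCs of $G$ of size exactly $k$, and $\dot{\mathfrak{c}}(G;k)$ the number of distinct true CDCs of $G$ of size exactly $k$. *)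

theory Defs
  imports "HOL-Analysis.Analysis" "HOL-Library.Multiset"
begin

type_synonym 'a ugraph = "'a set \<times> 'a set set"

abbreviation verts :: "'a ugraph \<Rightarrow> 'a set" where
  "verts \<equiv> fst"

abbreviation edges :: "'a ugraph \<Rightarrow> 'a set set" where
  "edges \<equiv> snd"

definition simple_graph :: "'a ugraph \<Rightarrow> bool" where
  "simple_graph G \<longleftrightarrow>
     finite (verts G) \<and>
     (\<forall>e\<in>edges G. \<exists>u\<in>verts G. \<exists>v\<in>verts G. u \<noteq> v \<and> e = {u, v})"

definition subgraph :: "'a ugraph \<Rightarrow> 'a ugraph \<Rightarrow> bool" where
  "subgraph H G \<longleftrightarrow> simple_graph H \<and> verts H \<subseteq> verts G \<and> edges H \<subseteq> edges G"

definition graph_adj :: "'a ugraph \<Rightarrow> 'a \<Rightarrow> 'a \<Rightarrow> bool" where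
  "graph_adj G u v \<longleftrightarrow> {u, v} \<in> edges G"

definition graph_connected :: "'a ugraph \<Rightarrow> bool" where
  "graph_connected G \<longleftrightarrow>
     verts G \<noteq> {} \<and> (\<forall>u\<in>verts G. \<forall>v\<in>verts G. (graph_adj G)\<^sup>*\<^sup>* u v)"

definition graph_degree :: "'a ugraph \<Rightarrow> 'a \<Rightarrow> nat" where
  "graph_degree G v = card {e \<in> edges G. v \<in> e}"

definition delete_verts :: "'a ugraph \<Rightarrow> 'a set \<Rightarrow> 'a ugraph" where
  "delete_verts G X = (verts G - X, {e \<in> edges G. e \<inter> X = {}})"

definition k_connected :: "nat \<Rightarrow> 'a ugraph \<Rightarrow> bool" where
  "k_connected k G \<longleftrightarrow>
     card (verts G) > k \<and>
     (\<forall>X \<subseteq> verts G. card X < k \<longrightarrow> graph_connected (delete_verts G X))"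

definition is_cycle :: "'a ugraph \<Rightarrow> bool" where
  "is_cycle C \<longleftrightarrow>
     simple_graph C \<and> graph_connected C \<and> (\<forall>v\<in>verts C. graph_degree C v = 2)"

definition cycle_double_cover :: "'a ugraph \<Rightarrow> 'a ugraph multiset \<Rightarrow> bool" where
  "cycle_double_cover G M \<longleftrightarrow>
     (\<forall>C\<in>#M. is_cycle C \<and> subgraph C G) \<and>
     (\<forall>e\<in>edges G. size {#C \<in># M. e \<in> edges C#} = 2)"

definition true_cycle_double_cover :: "'a ugraph \<Rightarrow> 'a ugraph multiset \<Rightarrow> bool" where
  "true_cycle_double_cover G M \<longleftrightarrow>
     cycle_double_cover G M \<and> (\<forall>C. count M C \<le> 1)"

definition num_cdc :: "'a ugraph \<Rightarrow> nat \<Rightarrow> nat" where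
  "num_cdc G k = card {M. cycle_double_cover G M \<and> size M = k}"

definition num_true_cdc :: "'a ugraph \<Rightarrow> nat \<Rightarrow> nat" where
  "num_true_cdc G k = card {M. true_cycle_double_cover G M \<and> size M = k}"

text \<open>
  A plane graph is a simple graph \<open>G\<close> whose vertices are points of the plane, here \<open>complex\<close>,
  together with a map \<open>d\<close> sending each edge \<open>{u, v}\<close> to (the point set of) an arc from \<open>u\<close> to \<open>v\<close>.
  The interior \<open>d e - e\<close> of an edge contains no vertex and no point of any other edge.
\<close>

definition plane_graph :: "complex ugraph \<Rightarrow> (complex set \<Rightarrow> complex set) \<Rightarrow> bool" where
  "plane_graph G d \<longleftrightarrow>
     simple_graph G \<and>
     (\<forall>e\<in>edges G. \<exists>g. arc g \<and> path_image g = d e \<and> {pathstart g, pathfinish g} = e) \<and>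
     (\<forall>e\<in>edges G. (d e - e) \<inter> verts G = {}) \<and>
     (\<forall>e\<in>edges G. \<forall>e'\<in>edges G. e \<noteq> e' \<longrightarrow> (d e - e) \<inter> d e' = {})"

definition faces :: "complex ugraph \<Rightarrow> (complex set \<Rightarrow> complex set) \<Rightarrow> complex set set" where
  "faces G d = components (- (verts G \<union> (\<Union>e\<in>edges G. d e)))"

end

theory Submission
  imports Defs
begin

text \<open>
  The graph is a triangulated cylinder: \<open>l\<close> concentric \<open>k\<close>-cycles (rows), consecutive ones joined by
  \<open>2 k\<close> slanted edges into a band of \<open>2 k\<close> triangles.

  There are \<open>2 k (l - 1)\<close> slanted edges, and a cycle other than a row uses at least two of them. A double
  cover of size \<open>f\<close> therefore contains \<open>h \<ge> 2\<close> rows, and the total length \<open>3 f + 2 (k - 3)\<close> of its members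
  leaves only \<open>(k - 3) (2 - h) \<le> 0\<close> for the sum of the excesses \<open>length - 3\<close> of the other cycles, so these
  are facial triangles. Covering the slanted edges of a band twice forces all its triangles with base on the
  lower row to have the same multiplicity \<open>x\<close>, and those with base on the upper row multiplicity \<open>2 - x\<close>;
  covering the row edges makes \<open>x\<close> nonincreasing from 2 to 0 along the cylinder, dropping exactly at the
  two rows \<open>a \<le> b\<close> of the cover. Every pair \<open>a \<le> b\<close> occurs, and only the extreme pair repeats no cycle.

  The cylinder is drawn by wrapping a triangular lattice strip around the origin with the exponential map.
\<close>

section \<open>Cycles and multisets of cycles\<close>

text \<open>Degree two at \<open>u\<close> supplies a second edge there. This is the step by which a
  cycle is followed onward from a known edge.\<close>

lemma cycle_other_edge:
  assumes "is_cycle C" and "{u, v} \<in> edges C"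
  obtains w where "w \<noteq> u" and "w \<noteq> v" and "{u, w} \<in> edges C"
proof -
  have sg: "simple_graph C" using assms by (simp add: is_cycle_def)
  then obtain a b where ab: "a \<in> verts C" "b \<in> verts C" "a \<noteq> b" "{u, v} = {a, b}"
    using assms(2) unfolding simple_graph_def by blast
  then have "u \<in> verts C" by (auto simp: doubleton_eq_iff)
  then have "card {e \<in> edges C. u \<in> e} = 2"
    using assms(1) by (simp add: is_cycle_def graph_degree_def)
  then obtain e e' where e: "{e \<in> edges C. u \<in> e} = {e, e'}" "e \<noteq> e'"
    by (auto simp: card_2_iff)
  then obtain e'' where e'': "e'' \<in> edges C" "u \<in> e''" "e'' \<noteq> {u, v}"
    by blast
  then obtain a b where "a \<noteq> b" "e'' = {a, b}"
    using sg unfolding simple_graph_def by blast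
  then obtain w where "e'' = {u, w}" "w \<noteq> u"
    using e''(2) by (auto simp: insert_commute)
  then show ?thesis
    using e'' that by blast
qed

lemma is_cycle_triangle:
  assumes "u \<noteq> v" "u \<noteq> w" "v \<noteq> w"
  shows "is_cycle ({u, v, w}, {{u, v}, {u, w}, {v, w}})"
proof -
  let ?C = "({u, v, w}, {{u, v}, {u, w}, {v, w}})"
  have s: "simple_graph ?C" using assms by (auto simp: simple_graph_def)
  have "graph_adj ?C a b" if "a \<in> {u, v, w}" "b \<in> {u, v, w}" "a \<noteq> b" for a b
    using that by (auto simp: graph_adj_def insert_commute)
  then have c: "graph_connected ?C"
    unfolding graph_connected_def by (metis empty_not_insert fst_conv r_into_rtranclp rtranclp.rtrancl_refl)
  have "{e \<in> edges ?C. u \<in> e} = {{u, v}, {u, w}}"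
       "{e \<in> edges ?C. v \<in> e} = {{u, v}, {v, w}}"
       "{e \<in> edges ?C. w \<in> e} = {{u, w}, {v, w}}"
    using assms by auto
  then have "\<forall>x\<in>{u, v, w}. graph_degree ?C x = 2"
    unfolding graph_degree_def using assms by (auto simp: doubleton_eq_iff)
  then show ?thesis using s c by (simp add: is_cycle_def)
qed

lemma simple_graph_finite_edges:
  assumes "simple_graph C"
  shows "finite (edges C)"
proof -
  have "edges C \<subseteq> Pow (verts C)" using assms by (auto simp: simple_graph_def)
  then show ?thesis using assms by (meson finite_Pow_iff finite_subset simple_graph_def)
qed

text \<open>Degree two leaves no isolated vertices, so a cycle is determined by its edge set; later
  comparisons of cycles look at edges only.\<close>

lemma cycle_verts_eq:
  assumes "is_cycle C"
  shows "verts C = \<Union>(edges C)"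
proof
  show "verts C \<subseteq> \<Union>(edges C)"
  proof
    fix v assume "v \<in> verts C"
    then have "card {e \<in> edges C. v \<in> e} = 2"
      using assms by (simp add: is_cycle_def graph_degree_def)
    then have "{e \<in> edges C. v \<in> e} \<noteq> {}" by (metis card.empty zero_neq_numeral)
    then show "v \<in> \<Union>(edges C)" by blast
  qed
  show "\<Union>(edges C) \<subseteq> verts C" using assms by (auto simp: is_cycle_def simple_graph_def)
qed

lemma is_cycle_eqI:
  assumes "is_cycle C" "is_cycle D" "edges C = edges D"
  shows "C = D"
  using assms cycle_verts_eq[of C] cycle_verts_eq[of D] by (simp add: prod_eq_iff)

lemma cycle_edges_nonempty: "is_cycle C \<Longrightarrow> edges C \<noteq> {}"
  by (metis Union_empty cycle_verts_eq graph_connected_def is_cycle_def)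

lemma cycle_edgeE:
  assumes "is_cycle C" "e \<in> edges C"
  obtains u v where "u \<noteq> v" "e = {u, v}"
  using assms unfolding is_cycle_def simple_graph_def by blast

lemma cycle_card_ge_3:
  assumes "is_cycle C"
  shows "3 \<le> card (edges C)"
proof -
  obtain e where e: "e \<in> edges C" using cycle_edges_nonempty[OF assms] by blast
  then obtain u v where uv: "u \<noteq> v" "e = {u, v}" using cycle_edgeE assms by metis
  obtain w where w: "w \<noteq> u" "w \<noteq> v" "{u, w} \<in> edges C"
    using cycle_other_edge assms e uv by metis
  obtain w' where w': "w' \<noteq> v" "w' \<noteq> u" "{v, w'} \<in> edges C"
    using cycle_other_edge[of C v u] assms e uv by (metis insert_commute)
  have "card {{u, v}, {u, w}, {v, w'}} = 3"
    using uv w w' by (auto simp: doubleton_eq_iff card_insert_if)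
  moreover have "{{u, v}, {u, w}, {v, w'}} \<subseteq> edges C" using e uv w w' by auto
  ultimately show ?thesis
    by (metis assms card_mono simple_graph_finite_edges is_cycle_def)
qed

text \<open>The second edges at \<open>u\<close> and at \<open>v\<close> exhaust the three edges;
  the second edge at \<open>w\<close> can then only be the one coming from \<open>v\<close>.\<close>

lemma cycle_card_3_triangle:
  assumes C: "is_cycle C" and c3: "card (edges C) = 3" and e: "{u, v} \<in> edges C" and "u \<noteq> v"
  obtains w where "w \<noteq> u" "w \<noteq> v" "edges C = {{u, v}, {u, w}, {v, w}}"
proof -
  obtain w where w: "w \<noteq> u" "w \<noteq> v" "{u, w} \<in> edges C"
    using cycle_other_edge C e by metis
  obtain w' where w': "w' \<noteq> v" "w' \<noteq> u" "{v, w'} \<in> edges C"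
    using cycle_other_edge[of C v u] C e by (metis insert_commute)
  have "card {{u, v}, {u, w}, {v, w'}} = 3"
    using \<open>u \<noteq> v\<close> w w' by (auto simp: doubleton_eq_iff card_insert_if)
  moreover have "{{u, v}, {u, w}, {v, w'}} \<subseteq> edges C" using e w w' by auto
  moreover have "finite (edges C)" using C by (simp add: simple_graph_finite_edges is_cycle_def)
  ultimately have ed: "edges C = {{u, v}, {u, w}, {v, w'}}"
    using c3 by (metis card_subset_eq)
  have "{w, u} \<in> edges C" using w by (simp add: insert_commute)
  then obtain x where "x \<noteq> w" "x \<noteq> u" "{w, x} \<in> edges C"
    using cycle_other_edge C by metis
  then have "w = w'" using w w' \<open>u \<noteq> v\<close> unfolding ed by (auto simp: doubleton_eq_iff)
  then show ?thesis using that w ed by blast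
qed

text \<open>Degree counting over \<open>T\<close>: a cycle crosses every vertex cut an even number of times.\<close>

lemma cycle_even_cut:
  assumes C: "is_cycle C"
  shows "even (\<Sum>e\<in>edges C. card (e \<inter> T))"
proof -
  have sg: "simple_graph C" using C by (simp add: is_cycle_def)
  have fv: "finite (verts C)" using sg by (simp add: simple_graph_def)
  have fe: "finite (edges C)" using sg by (rule simple_graph_finite_edges)
  have sub: "e \<subseteq> verts C" if "e \<in> edges C" for e using sg that by (auto simp: simple_graph_def)
  have "(\<Sum>e\<in>edges C. card (e \<inter> T)) = (\<Sum>e\<in>edges C. \<Sum>v\<in>verts C \<inter> T. if v \<in> e then 1 else 0)"
  proof (rule sum.cong)
    fix e assume "e \<in> edges C"
    then have "e \<inter> T = {v \<in> verts C \<inter> T. v \<in> e}" using sub by auto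
    then show "card (e \<inter> T) = (\<Sum>v\<in>verts C \<inter> T. if v \<in> e then 1 else 0)"
      using fv by (simp add: sum.inter_filter[symmetric])
  qed simp
  also have "\<dots> = (\<Sum>v\<in>verts C \<inter> T. \<Sum>e\<in>edges C. if v \<in> e then 1 else 0)"
    by (rule sum.swap)
  also have "\<dots> = (\<Sum>v\<in>verts C \<inter> T. graph_degree C v)"
    using fe by (simp add: graph_degree_def sum.inter_filter[symmetric])
  also have "\<dots> = (\<Sum>v\<in>verts C \<inter> T. 2)"
    using C by (intro sum.cong) (auto simp: is_cycle_def)
  finally show ?thesis by simp
qed

text \<open>Double counting of incidences between members of \<open>M\<close> and edges in
  \<open>T\<close>. If \<open>M\<close> covers each edge in \<open>T\<close> twice, the total is
  \<open>2 * card T\<close>.\<close>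

lemma sum_mset_card_Int:
  assumes "finite T"
  shows "(\<Sum>C\<in>#M. card (edges C \<inter> T)) = (\<Sum>e\<in>T. size {#C \<in># M. e \<in> edges C#})"
proof (induction M)
  case (add C M)
  have "card (edges C \<inter> T) = card {e \<in> T. e \<in> edges C}"
    by (rule arg_cong[where f = card]) auto
  also have "\<dots> = (\<Sum>e\<in>T. if e \<in> edges C then 1 else 0)"
    using assms by (simp add: sum.inter_filter[symmetric])
  finally have "(\<Sum>C\<in>#add_mset C M. card (edges C \<inter> T)) =
      (\<Sum>e\<in>T. (if e \<in> edges C then 1 else 0) + size {#C \<in># M. e \<in> edges C#})"
    using add by (simp add: sum.distrib)
  also have "\<dots> = (\<Sum>e\<in>T. size {#C \<in># add_mset C M. e \<in> edges C#})"
    by (intro sum.cong) auto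
  finally show ?case .
qed simp

text \<open>\<open>K\<close> may list candidates that do not occur in \<open>M\<close>, since these
  count 0. The coverage of an edge thus becomes a sum over a fixed list of cycles, the same for
  every cover.\<close>

lemma size_filter_mset_eq_sum_count:
  assumes "finite K" and "\<And>C. C \<in> K \<Longrightarrow> P C" and "\<And>C. C \<in># M \<Longrightarrow> P C \<Longrightarrow> C \<in> K"
  shows "size (filter_mset P M) = (\<Sum>C\<in>K. count M C)"
proof -
  have "size (filter_mset P M) = (\<Sum>C\<in>set_mset (filter_mset P M). count (filter_mset P M) C)"
    by (simp add: size_multiset_overloaded_eq)
  also have "\<dots> = (\<Sum>C\<in>K. count (filter_mset P M) C)"
    using assms by (intro sum.mono_neutral_left) (auto simp: not_in_iff)
  also have "\<dots> = (\<Sum>C\<in>K. count M C)"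
    using assms by (intro sum.cong) auto
  finally show ?thesis .
qed

section \<open>The triangulated cylinder\<close>

lemma int_dvd_small_imp_zero:
  fixes d :: int
  assumes "int k dvd d" "\<bar>d\<bar> < int k"
  shows "d = 0"
  using assms by (metis dvd_imp_le_int abs_of_nat not_le)

lemma int_shift_induct:
  assumes "P (j0 :: int)" "\<And>j. P j \<Longrightarrow> P (j + 1)" "\<And>j. P j \<Longrightarrow> P (j - 1)"
  shows "P j"
  using assms by (induction j rule: int_induct[of _ j0]) auto

text \<open>Columns range over all integers, and \<open>p i\<close> identifies those congruent
  modulo \<open>k\<close>: the neighbours \<open>j + 1\<close> and \<open>j - 1\<close> need no
  reduction, and induction can walk around a row in either direction. Leaving \<open>p\<close>
  abstract separates the combinatorics from the drawing.\<close>

locale cylinder_grid =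
  fixes k l :: nat and p :: "nat \<Rightarrow> int \<Rightarrow> 'a"
  assumes k3: "3 \<le> k" and l2: "2 \<le> l"
    and p_eq_iff: "p i j = p i' j' \<longleftrightarrow> i = i' \<and> int k dvd j - j'"
begin

definition V :: "'a set" where
  "V = {p i j | i j. i < l}"

definition hE :: "nat \<Rightarrow> int \<Rightarrow> 'a set" where "hE i j = {p i j, p i (j + 1)}"
definition vE :: "nat \<Rightarrow> int \<Rightarrow> 'a set" where "vE i j = {p i j, p (Suc i) j}"
definition dE :: "nat \<Rightarrow> int \<Rightarrow> 'a set" where "dE i j = {p i j, p (Suc i) (j + 1)}"

definition horizontal :: "'a set set" where
  "horizontal = {hE i j | i j. i < l}"

definition slanted :: "'a set set" where
  "slanted = {vE i j | i j. Suc i < l} \<union> {dE i j | i j. Suc i < l}"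

definition G :: "'a ugraph" where
  "G = (V, horizontal \<union> slanted)"

definition row :: "nat \<Rightarrow> 'a ugraph" where
  "row i = (range (p i), range (hE i))"

definition lowT :: "nat \<Rightarrow> int \<Rightarrow> 'a ugraph" where
  "lowT i j = ({p i j, p i (j + 1), p (Suc i) (j + 1)}, {hE i j, dE i j, vE i (j + 1)})"

definition upT :: "nat \<Rightarrow> int \<Rightarrow> 'a ugraph" where
  "upT i j = ({p i j, p (Suc i) j, p (Suc i) (j + 1)}, {vE i j, dE i j, hE (Suc i) j})"

lemma k_small: "\<bar>d\<bar> < 3 \<Longrightarrow> int k dvd d \<longleftrightarrow> d = 0"
  using int_dvd_small_imp_zero[of k d] k3 by auto

lemma not_dvd_1: "\<not> int k dvd 1" "\<not> int k dvd - 1" "\<not> int k dvd 2" "\<not> int k dvd - 2"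
  by (simp_all add: k_small del: dvd_minus_iff zdvd1_eq)

lemma p_neq: "p i j \<noteq> p i (j + 1)" "p i (j + 1) \<noteq> p i j"
  "p i (j - 1) \<noteq> p i j" "p i j \<noteq> p i (j - 1)" "p i (j - 1) \<noteq> p i (j + 1)" "p i (j + 1) \<noteq> p i (j - 1)"
  using not_dvd_1 by (auto simp: p_eq_iff)

text \<open>Two row edges could also agree with their ends swapped; then \<open>k\<close> would
  divide 2, which \<open>3 \<le> k\<close> excludes.\<close>

lemma hE_eq_iff: "hE i j = hE i' j' \<longleftrightarrow> i = i' \<and> int k dvd j - j'"
proof -
  have "\<not> (int k dvd j - (j' + 1) \<and> int k dvd j + 1 - j')"
    using dvd_diff[of "int k" "j + 1 - j'" "j - (j' + 1)"] not_dvd_1 by auto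
  then show ?thesis by (auto simp: hE_def doubleton_eq_iff p_eq_iff)
qed

lemma vE_eq_iff: "vE i j = vE i' j' \<longleftrightarrow> i = i' \<and> int k dvd j - j'"
  by (auto simp: vE_def doubleton_eq_iff p_eq_iff)

lemma dE_eq_iff: "dE i j = dE i' j' \<longleftrightarrow> i = i' \<and> int k dvd j - j'"
  by (auto simp: dE_def doubleton_eq_iff p_eq_iff)

lemma vE_neq_dE: "vE i j \<noteq> dE i' j'" "dE i' j' \<noteq> vE i j"
proof -
  have "\<not> (int k dvd j - j' \<and> int k dvd j - (j' + 1))"
    using dvd_diff[of "int k" "j - j'" "j - (j' + 1)"] not_dvd_1 by auto
  then show "vE i j \<noteq> dE i' j'" by (auto simp: vE_def dE_def doubleton_eq_iff p_eq_iff)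
  then show "dE i' j' \<noteq> vE i j" by simp
qed

lemma hE_neq: "hE i j \<noteq> vE i' j'" "vE i' j' \<noteq> hE i j" "hE i j \<noteq> dE i' j'" "dE i' j' \<noteq> hE i j"
  by (auto simp: hE_def vE_def dE_def doubleton_eq_iff p_eq_iff)

lemmas edge_simps = hE_eq_iff vE_eq_iff dE_eq_iff vE_neq_dE hE_neq

section \<open>Restriction to one period; counting vertices and edges\<close>

lemma mod_k_dvd: "int k dvd j - j mod int k" "int k dvd j mod int k - j"
proof -
  show "int k dvd j - j mod int k" by (simp add: minus_mod_eq_mult_div)
  then show "int k dvd j mod int k - j" by (subst dvd_diff_commute)
qed

lemma mod_k_bounds: "j mod int k \<in> {0..<int k}"
  using k3 by simp

lemma residue_eq_iff:
  assumes "j \<in> {0..<int k}" "j' \<in> {0..<int k}"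
  shows "int k dvd j - j' \<longleftrightarrow> j = j'"
  using int_dvd_small_imp_zero[of k "j - j'"] assms by auto

lemma periodic_range:
  assumes "\<And>j. f j = f (j mod int k)"
  shows "range f = f ` {0..<int k}"
proof
  show "range f \<subseteq> f ` {0..<int k}"
  proof
    fix x assume "x \<in> range f"
    then obtain j where "x = f (j mod int k)" using assms by blast
    then show "x \<in> f ` {0..<int k}" using mod_k_bounds by blast
  qed
qed blast

text \<open>Replaces the integer columns by one period, on which vertices and edges of a kind are
  pairwise distinct and can be counted.\<close>

lemma periodic_family:
  assumes "\<And>i j. f i j = f i (j mod int k)"
  shows "{f i j | i j. i < n} = (\<lambda>(i, j). f i j) ` ({..<n} \<times> {0..<int k})"
proof -
  have "{f i j | i j. i < n} = (\<Union>i<n. range (f i))" by blast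
  also have "\<dots> = (\<Union>i<n. f i ` {0..<int k})"
    using periodic_range[of "f _", OF assms] by simp
  finally show ?thesis by auto
qed

lemma V_eq: "V = (\<lambda>(i, j). p i j) ` ({..<l} \<times> {0..<int k})"
  unfolding V_def by (rule periodic_family) (simp add: p_eq_iff mod_k_dvd)

lemma finite_V: "finite V" by (simp add: V_eq)

lemma card_V: "card V = l * k"
  unfolding V_eq by (subst card_image) (auto simp: inj_on_def p_eq_iff residue_eq_iff)

lemma horizontal_eq: "horizontal = (\<lambda>(i, j). hE i j) ` ({..<l} \<times> {0..<int k})"
  unfolding horizontal_def by (rule periodic_family) (simp add: hE_eq_iff mod_k_dvd)

lemma card_horizontal: "finite horizontal" "card horizontal = l * k"
  unfolding horizontal_eq
  by simp (subst card_image, auto simp: inj_on_def hE_eq_iff residue_eq_iff)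

lemma slanted_eq: "slanted = (\<lambda>(i, j). vE i j) ` ({..<l - 1} \<times> {0..<int k})
    \<union> (\<lambda>(i, j). dE i j) ` ({..<l - 1} \<times> {0..<int k})"
proof -
  have "Suc i < l \<longleftrightarrow> i < l - 1" for i by auto
  then have "slanted = {vE i j | i j. i < l - 1} \<union> {dE i j | i j. i < l - 1}"
    by (simp add: slanted_def)
  also have "{vE i j | i j. i < l - 1} = (\<lambda>(i, j). vE i j) ` ({..<l - 1} \<times> {0..<int k})"
    by (rule periodic_family) (simp add: vE_eq_iff mod_k_dvd)
  also have "{dE i j | i j. i < l - 1} = (\<lambda>(i, j). dE i j) ` ({..<l - 1} \<times> {0..<int k})"
    by (rule periodic_family) (simp add: dE_eq_iff mod_k_dvd)
  finally show ?thesis .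
qed

lemma card_slanted: "finite slanted" "card slanted = 2 * k * (l - 1)"
proof -
  let ?I = "{..<l - 1} \<times> {0..<int k}"
  show "finite slanted" by (simp add: slanted_eq)
  have "card ((\<lambda>(i, j). vE i j) ` ?I) = card ?I" "card ((\<lambda>(i, j). dE i j) ` ?I) = card ?I"
    by (rule card_image; auto simp: inj_on_def vE_eq_iff dE_eq_iff residue_eq_iff)+
  moreover have "card slanted = card ((\<lambda>(i, j). vE i j) ` ?I) + card ((\<lambda>(i, j). dE i j) ` ?I)"
    unfolding slanted_eq by (rule card_Un_disjoint) (auto simp: vE_neq_dE)
  ultimately show "card slanted = 2 * k * (l - 1)" by simp
qed

lemma horizontal_slanted_disjoint: "horizontal \<inter> slanted = {}"
  by (auto simp: horizontal_def slanted_def hE_neq)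

lemma simple_graph_G: "simple_graph G"
proof -
  have "\<exists>u\<in>V. \<exists>v\<in>V. u \<noteq> v \<and> hE i j = {u, v}" if "i < l" for i j
    using that p_neq by (auto simp: hE_def V_def)
  moreover have "\<exists>u\<in>V. \<exists>v\<in>V. u \<noteq> v \<and> vE i j = {u, v}"
      "\<exists>u\<in>V. \<exists>v\<in>V. u \<noteq> v \<and> dE i j = {u, v}" if "Suc i < l" for i j
  proof -
    have "p i j \<in> V" "p (Suc i) j \<in> V" "p (Suc i) (j + 1) \<in> V"
      using that Suc_lessD by (auto simp: V_def)
    then show "\<exists>u\<in>V. \<exists>v\<in>V. u \<noteq> v \<and> vE i j = {u, v}"
      "\<exists>u\<in>V. \<exists>v\<in>V. u \<noteq> v \<and> dE i j = {u, v}"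
      unfolding vE_def dE_def by (metis n_not_Suc_n p_eq_iff)+
  qed
  ultimately show ?thesis
    by (auto simp: simple_graph_def G_def finite_V horizontal_def slanted_def)
qed

lemma adj_horizontal:
  assumes "{p i j, y} \<in> horizontal"
  shows "y = p i (j + 1) \<or> y = p i (j - 1)"
proof -
  obtain i' j' where "{p i j, y} = hE i' j'" using assms by (auto simp: horizontal_def)
  then show ?thesis
    by (auto simp: hE_def doubleton_eq_iff p_eq_iff dvd_diff_commute algebra_simps)
qed

lemma adj_slanted:
  assumes "{p i j, y} \<in> slanted"
  shows "y = p (Suc i) j \<or> y = p (Suc i) (j + 1) \<or>
         (0 < i \<and> (y = p (i - 1) j \<or> y = p (i - 1) (j - 1)))"
proof -
  obtain i' j' where "{p i j, y} = vE i' j' \<or> {p i j, y} = dE i' j'"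
    using assms by (auto simp: slanted_def)
  then show ?thesis
    by (auto simp: vE_def dE_def doubleton_eq_iff p_eq_iff dvd_diff_commute algebra_simps)
qed

lemma hE_in_G: "i < l \<Longrightarrow> hE i j \<in> edges G"
  and vE_in_G: "Suc i < l \<Longrightarrow> vE i j \<in> edges G"
  and dE_in_G: "Suc i < l \<Longrightarrow> dE i j \<in> edges G"
  by (auto simp: G_def horizontal_def slanted_def)

section \<open>Rows and facial triangles as cycles of the graph\<close>

lemma lowT_cycle: "is_cycle (lowT i j)"
  using is_cycle_triangle[of "p i j" "p i (j + 1)" "p (Suc i) (j + 1)"] p_neq
  by (simp add: lowT_def hE_def dE_def vE_def p_eq_iff)

lemma upT_cycle: "is_cycle (upT i j)"
  using is_cycle_triangle[of "p i j" "p (Suc i) j" "p (Suc i) (j + 1)"] p_neq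
  by (simp add: upT_def hE_def dE_def vE_def p_eq_iff)

lemma row_cycle: "is_cycle (row i)"
proof -
  have s: "simple_graph (row i)"
  proof -
    have "range (p i) = p i ` {0..<int k}"
      by (rule periodic_range) (simp add: p_eq_iff mod_k_dvd)
    then have "finite (range (p i))" by simp
    then show ?thesis using p_neq by (auto simp: simple_graph_def row_def hE_def)
  qed
  have "(graph_adj (row i))\<^sup>*\<^sup>* (p i j0) (p i j)" for j0 j
  proof (induction j rule: int_shift_induct[where ?j0.0 = j0])
    case (2 j)
    moreover have "graph_adj (row i) (p i j) (p i (j + 1))"
      by (auto simp: graph_adj_def row_def hE_def)
    ultimately show ?case by (rule rtranclp.rtrancl_into_rtrancl)
  next
    case (3 j)
    moreover have "{p i j, p i (j - 1)} = hE i (j - 1)" by (auto simp: hE_def)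
    then have "graph_adj (row i) (p i j) (p i (j - 1))"
      by (auto simp: graph_adj_def row_def)
    ultimately show ?case by (rule rtranclp.rtrancl_into_rtrancl)
  qed simp
  then have c: "graph_connected (row i)" by (auto simp: graph_connected_def row_def)
  have "graph_degree (row i) (p i j) = 2" for j
  proof -
    have "{e \<in> edges (row i). p i j \<in> e} = {hE i j, hE i (j - 1)}"
    proof
      show "{e \<in> edges (row i). p i j \<in> e} \<subseteq> {hE i j, hE i (j - 1)}"
        by (auto simp: row_def hE_eq_iff) (auto simp: hE_def p_eq_iff dvd_diff_commute algebra_simps)
      show "{hE i j, hE i (j - 1)} \<subseteq> {e \<in> edges (row i). p i j \<in> e}"
        by (auto simp: row_def hE_def)
    qed
    moreover have "hE i j \<noteq> hE i (j - 1)" using not_dvd_1 by (simp add: hE_eq_iff)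
    ultimately show ?thesis by (simp add: graph_degree_def)
  qed
  then have "\<forall>v\<in>verts (row i). graph_degree (row i) v = 2" by (auto simp: row_def)
  then show ?thesis using s c by (simp add: is_cycle_def)
qed

lemma row_subgraph: "i < l \<Longrightarrow> subgraph (row i) G"
  using row_cycle[of i]
  by (auto simp: subgraph_def is_cycle_def) (auto simp: row_def G_def V_def horizontal_def)

lemma lowT_subgraph: "Suc i < l \<Longrightarrow> subgraph (lowT i j) G"
  using lowT_cycle[of i j] unfolding subgraph_def is_cycle_def
  by (intro conjI) (auto simp: lowT_def G_def V_def horizontal_def slanted_def)

lemma upT_subgraph: "Suc i < l \<Longrightarrow> subgraph (upT i j) G"
  using upT_cycle[of i j] unfolding subgraph_def is_cycle_def
  by (intro conjI) (auto simp: upT_def G_def V_def horizontal_def slanted_def)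

section \<open>Row length, and classification of cycles by their slanted edges\<close>

lemma card_row: "card (edges (row i)) = k"
proof -
  have "edges (row i) = hE i ` {0..<int k}"
    unfolding row_def snd_conv by (rule periodic_range) (simp add: hE_eq_iff mod_k_dvd)
  moreover have "inj_on (hE i) {0..<int k}"
    by (auto simp: inj_on_def hE_eq_iff residue_eq_iff)
  ultimately show ?thesis by (simp add: card_image)
qed

text \<open>Along row edges a vertex has only its two row neighbours, so degree two makes the cycle
  continue around the row in both directions, and connectedness keeps it in that row.\<close>

lemma flat_cycle_is_row:
  assumes C: "is_cycle C" and "edges C \<subseteq> horizontal"
  shows "\<exists>i<l. C = row i"
proof -
  obtain e where "e \<in> edges C" using cycle_edges_nonempty[OF C] by blast
  then obtain i j0 where ij: "i < l" "e = hE i j0" "hE i j0 \<in> edges C"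
    using assms by (auto simp: horizontal_def)
  have step: "hE i (j + 1) \<in> edges C" if "hE i j \<in> edges C" for j
  proof -
    have "{p i (j + 1), p i j} \<in> edges C" using that by (simp add: hE_def insert_commute)
    then obtain w where w: "w \<noteq> p i j" "{p i (j + 1), w} \<in> edges C"
      using cycle_other_edge C by metis
    then have "w = p i (j + 1 + 1) \<or> w = p i (j + 1 - 1)" using assms adj_horizontal by blast
    then have "w = p i (j + 1 + 1)" using w by auto
    then show ?thesis using w by (simp add: hE_def)
  qed
  have step': "hE i (j - 1) \<in> edges C" if "hE i j \<in> edges C" for j
  proof -
    have "{p i j, p i (j + 1)} \<in> edges C" using that by (simp add: hE_def)
    then obtain w where w: "w \<noteq> p i (j + 1)" "{p i j, w} \<in> edges C"
      using cycle_other_edge C by metis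
    then have "w = p i (j + 1) \<or> w = p i (j - 1)" using assms adj_horizontal by blast
    then have "w = p i (j - 1)" using w by auto
    then show ?thesis using w by (simp add: hE_def insert_commute)
  qed
  have sup: "hE i j \<in> edges C" for j
    by (rule int_shift_induct[where P = "\<lambda>j. hE i j \<in> edges C", OF ij(3) step step'])
  have v0: "p i j0 \<in> verts C" using ij(3) cycle_verts_eq[OF C] by (auto simp: hE_def)
  have reach: "u \<in> range (p i)" if "(graph_adj C)\<^sup>*\<^sup>* (p i j0) u" for u
    using that
  proof (induction rule: rtranclp_induct)
    case (step y z)
    then obtain j where "y = p i j" by blast
    then have "{p i j, z} \<in> horizontal" using step assms by (auto simp: graph_adj_def)
    then show ?case using adj_horizontal by blast
  qed simp
  have "edges C \<subseteq> range (hE i)"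
  proof
    fix e assume e: "e \<in> edges C"
    then obtain i' j' where e': "e = hE i' j'" using assms by (auto simp: horizontal_def)
    then have "p i' j' \<in> verts C" using e cycle_verts_eq[OF C] by (auto simp: hE_def)
    then have "p i' j' \<in> range (p i)"
      using reach v0 C by (simp add: is_cycle_def graph_connected_def)
    then show "e \<in> range (hE i)" using e' by (auto simp: p_eq_iff)
  qed
  then have "edges C = edges (row i)" using sup by (auto simp: row_def)
  then show ?thesis using is_cycle_eqI[OF C row_cycle] ij(1) by blast
qed

text \<open>A single slanted edge would be the only edge of the cycle crossing between the rows up
  to \<open>i\<close> and the rest, against the parity of cuts.\<close>

lemma slanted_cycle_ge_2:
  assumes C: "is_cycle C" and sub: "edges C \<subseteq> horizontal \<union> slanted"
    and ns: "edges C \<inter> slanted \<noteq> {}"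
  shows "2 \<le> card (edges C \<inter> slanted)"
proof (rule ccontr)
  assume "\<not> ?thesis"
  moreover have "finite (edges C \<inter> slanted)" using card_slanted by blast
  ultimately have "card (edges C \<inter> slanted) = 1"
    using ns by (metis One_nat_def Suc_leI card_gt_0_iff le_antisym not_less_eq_eq numeral_2_eq_2)
  then obtain e where e: "edges C \<inter> slanted = {e}" by (auto simp: card_1_singleton_iff)
  then have "e \<in> slanted" by blast
  then obtain i j where ij: "e = vE i j \<or> e = dE i j" by (auto simp: slanted_def)
  \<comment> \<open>The rows up to \<open>i\<close>: a row edge meets them in 0 or 2 vertices, the
    slanted edge \<open>e\<close> in exactly one.\<close>
  define T where "T = {p i' j' | i' j'. i' \<le> i}"
  have pT: "p i' j' \<in> T \<longleftrightarrow> i' \<le> i" for i' j'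
  proof
    show "i' \<le> i" if "p i' j' \<in> T" using that by (auto simp: T_def p_eq_iff)
    show "p i' j' \<in> T" if "i' \<le> i" using that unfolding T_def by blast
  qed
  have "e \<inter> T = {p i j}" using ij pT by (auto simp: vE_def dE_def)
  then have "card (e \<inter> T) = 1" by simp
  moreover have "even (card (e' \<inter> T))" if "e' \<in> edges C - {e}" for e'
  proof -
    have "e' \<in> horizontal" using that e sub by blast
    then obtain i' j' where h: "e' = {p i' j', p i' (j' + 1)}"
      by (auto simp: horizontal_def hE_def)
    show ?thesis
    proof (cases "i' \<le> i")
      case True
      then have "e' \<inter> T = e'" using h pT by auto
      then show ?thesis using h p_neq by simp
    next
      case False
      then have "e' \<inter> T = {}" using h pT by auto
      then show ?thesis by simp
    qed
  qed
  then have "even (\<Sum>e'\<in>edges C - {e}. card (e' \<inter> T))" by (rule dvd_sum)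
  moreover have "(\<Sum>e'\<in>edges C. card (e' \<inter> T)) = card (e \<inter> T) + (\<Sum>e'\<in>edges C - {e}. card (e' \<inter> T))"
    using e C by (intro sum.remove) (auto simp: simple_graph_finite_edges is_cycle_def)
  ultimately show False using cycle_even_cut[OF C, of T] by simp
qed

text \<open>The ends of a slanted edge have just two common neighbours, one for each facial triangle
  on that edge. Requiring a slanted edge excludes the rows, which are triangles too when
  \<open>k = 3\<close>.\<close>

lemma slanted_triangle:
  assumes C: "is_cycle C" and sub: "edges C \<subseteq> horizontal \<union> slanted"
    and c3: "card (edges C) = 3" and ns: "edges C \<inter> slanted \<noteq> {}"
  shows "\<exists>i j. Suc i < l \<and> (C = lowT i j \<or> C = upT i j)"
proof -
  have adj: "y = p i (j + 1) \<or> y = p i (j - 1) \<or> y = p (Suc i) j \<or> y = p (Suc i) (j + 1) \<or>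
         (0 < i \<and> (y = p (i - 1) j \<or> y = p (i - 1) (j - 1)))"
    if "{p i j, y} \<in> edges C" for i j y
    using that sub adj_horizontal adj_slanted by blast
  have tri: "edges C = edges (lowT i j) \<Longrightarrow> C = lowT i j"
            "edges C = edges (upT i j) \<Longrightarrow> C = upT i j" for i j
    using is_cycle_eqI C lowT_cycle upT_cycle by blast+
  obtain e where e: "e \<in> edges C" "e \<in> slanted" using ns by blast
  then obtain i j where il: "Suc i < l" and ij: "e = vE i j \<or> e = dE i j" by (auto simp: slanted_def)
  from ij show ?thesis
  proof
    assume e': "e = vE i j"
    then obtain w where w: "w \<noteq> p i j" "w \<noteq> p (Suc i) j"
      and ed: "edges C = {{p i j, p (Suc i) j}, {p i j, w}, {p (Suc i) j, w}}"
      using cycle_card_3_triangle[OF C c3, of "p i j" "p (Suc i) j"] e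
      by (auto simp: vE_def p_eq_iff)
    have "w = p i (j - 1) \<or> w = p (Suc i) (j + 1)"
      using adj[of i j w] adj[of "Suc i" j w] w p_neq unfolding ed
      by (auto simp: p_eq_iff)
    then show ?thesis
    proof
      assume "w = p i (j - 1)"
      then have "edges C = edges (lowT i (j - 1))"
        unfolding ed by (auto simp: lowT_def hE_def vE_def dE_def insert_commute)
      then show ?thesis using tri il by blast
    next
      assume "w = p (Suc i) (j + 1)"
      then have "edges C = edges (upT i j)"
        unfolding ed by (auto simp: upT_def hE_def vE_def dE_def insert_commute)
      then show ?thesis using tri il by blast
    qed
  next
    assume e': "e = dE i j"
    then obtain w where w: "w \<noteq> p i j" "w \<noteq> p (Suc i) (j + 1)"
      and ed: "edges C = {{p i j, p (Suc i) (j + 1)}, {p i j, w}, {p (Suc i) (j + 1), w}}"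
      using cycle_card_3_triangle[OF C c3, of "p i j" "p (Suc i) (j + 1)"] e
      by (auto simp: dE_def p_eq_iff)
    have "w = p i (j + 1) \<or> w = p (Suc i) j"
      using adj[of i j w] adj[of "Suc i" "j + 1" w] w p_neq unfolding ed
      by (auto simp: p_eq_iff)
    then show ?thesis
    proof
      assume "w = p i (j + 1)"
      then have "edges C = edges (lowT i j)"
        unfolding ed by (auto simp: lowT_def hE_def vE_def dE_def insert_commute)
      then show ?thesis using tri il by blast
    next
      assume "w = p (Suc i) j"
      then have "edges C = edges (upT i j)"
        unfolding ed by (auto simp: upT_def hE_def vE_def dE_def insert_commute)
      then show ?thesis using tri il by blast
    qed
  qed
qed

end

section \<open>Double covers of size \<open>f\<close>\<close>

lemma sum_mset_ge_const:
  fixes f :: "'b \<Rightarrow> nat"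
  assumes "\<And>x. x \<in># M \<Longrightarrow> c \<le> f x"
  shows "c * size M \<le> (\<Sum>x\<in>#M. f x)"
  using assms
proof (induction M)
  case (add x M)
  have "c \<le> f x" "c * size M \<le> (\<Sum>x\<in>#M. f x)" using add by auto
  then show ?case by simp
qed simp

lemma ball_family: "(\<forall>e\<in>{f i j | i j. R i}. Q e) \<longleftrightarrow> (\<forall>i j. R i \<longrightarrow> Q (f i j))"
  by blast

context cylinder_grid
begin

section \<open>Edges and equality of rows and facial triangles\<close>

lemma in_edges_row: "hE i j \<in> edges (row i') \<longleftrightarrow> i = i'"
    "vE i j \<notin> edges (row i')" "dE i j \<notin> edges (row i')"
  by (auto simp: row_def edge_simps)

lemma in_edges_lowT: "hE i j \<in> edges (lowT i' j') \<longleftrightarrow> i = i' \<and> int k dvd j - j'"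
    "dE i j \<in> edges (lowT i' j') \<longleftrightarrow> i = i' \<and> int k dvd j - j'"
    "vE i j \<in> edges (lowT i' j') \<longleftrightarrow> i = i' \<and> int k dvd j - (j' + 1)"
  by (auto simp: lowT_def edge_simps)

lemma in_edges_upT: "hE i j \<in> edges (upT i' j') \<longleftrightarrow> i = Suc i' \<and> int k dvd j - j'"
    "dE i j \<in> edges (upT i' j') \<longleftrightarrow> i = i' \<and> int k dvd j - j'"
    "vE i j \<in> edges (upT i' j') \<longleftrightarrow> i = i' \<and> int k dvd j - j'"
  by (auto simp: upT_def edge_simps)

lemma row_eq_iff: "row i = row i' \<longleftrightarrow> i = i'"
  using in_edges_row(1)[of i 0 i] in_edges_row(1)[of i 0 i'] by auto

lemma lowT_eq_iff: "lowT i j = lowT i' j' \<longleftrightarrow> i = i' \<and> int k dvd j - j'"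
proof
  show "lowT i j = lowT i' j' \<Longrightarrow> i = i' \<and> int k dvd j - j'"
    using in_edges_lowT(1)[of i j i j] in_edges_lowT(1)[of i j i' j'] by simp
  assume "i = i' \<and> int k dvd j - j'"
  then have "hE i j = hE i' j'" "dE i j = dE i' j'" "vE i (j + 1) = vE i' (j' + 1)"
    by (auto simp: edge_simps)
  then have "edges (lowT i j) = edges (lowT i' j')" by (simp add: lowT_def)
  then show "lowT i j = lowT i' j'" using is_cycle_eqI lowT_cycle by blast
qed

lemma upT_eq_iff: "upT i j = upT i' j' \<longleftrightarrow> i = i' \<and> int k dvd j - j'"
proof
  show "upT i j = upT i' j' \<Longrightarrow> i = i' \<and> int k dvd j - j'"
    using in_edges_upT(2)[of i j i j] in_edges_upT(2)[of i j i' j'] by simp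
  assume "i = i' \<and> int k dvd j - j'"
  then have "vE i j = vE i' j'" "dE i j = dE i' j'" "hE (Suc i) j = hE (Suc i') j'"
    by (auto simp: edge_simps)
  then have "edges (upT i j) = edges (upT i' j')" by (simp add: upT_def)
  then show "upT i j = upT i' j'" using is_cycle_eqI upT_cycle by blast
qed

lemma pieces_neq: "row i \<noteq> lowT i' j'" "lowT i' j' \<noteq> row i" "row i \<noteq> upT i' j'" "upT i' j' \<noteq> row i"
    "lowT i' j' \<noteq> upT i'' j''" "upT i'' j'' \<noteq> lowT i' j'"
proof -
  show "row i \<noteq> lowT i' j'" using in_edges_lowT(2)[of i' j' i' j'] in_edges_row(3)[of i' j' i] by auto
  then show "lowT i' j' \<noteq> row i" by simp
  show "row i \<noteq> upT i' j'" using in_edges_upT(2)[of i' j' i' j'] in_edges_row(3)[of i' j' i] by auto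
  then show "upT i' j' \<noteq> row i" by simp
  show "lowT i' j' \<noteq> upT i'' j''"
  proof
    assume "lowT i' j' = upT i'' j''"
    then have "i' = i''" "i' = Suc i''"
      using in_edges_lowT(1,2)[of i' j' i' j'] in_edges_upT(1,2)[of i' j' i'' j''] by auto
    then show False by simp
  qed
  then show "upT i'' j'' \<noteq> lowT i' j'" by simp
qed

text \<open>All facial cycles (rows \<open>0\<close> and \<open>l - 1\<close> bound the two end
  faces) together with the inner rows.\<close>

definition pieces :: "'a ugraph set" where
  "pieces = {row i | i. i < l} \<union> {lowT i j | i j. Suc i < l} \<union> {upT i j | i j. Suc i < l}"

lemma piecesE:
  assumes "C \<in> pieces"
  obtains i where "i < l" "C = row i" | i j where "Suc i < l" "C = lowT i j"
    | i j where "Suc i < l" "C = upT i j"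
  using assms unfolding pieces_def by blast

lemma pieces_iff:
  "row i \<in> pieces \<longleftrightarrow> i < l" "lowT i j \<in> pieces \<longleftrightarrow> Suc i < l" "upT i j \<in> pieces \<longleftrightarrow> Suc i < l"
proof -
  show "row i \<in> pieces \<longleftrightarrow> i < l" by (simp add: pieces_def pieces_neq row_eq_iff)
  have "Suc i < l" if "lowT i j \<in> pieces"
    using that by (elim piecesE) (simp_all add: pieces_neq lowT_eq_iff)
  then show "lowT i j \<in> pieces \<longleftrightarrow> Suc i < l" unfolding pieces_def by blast
  have "Suc i < l" if "upT i j \<in> pieces"
    using that by (elim piecesE) (simp_all add: pieces_neq upT_eq_iff)
  then show "upT i j \<in> pieces \<longleftrightarrow> Suc i < l" unfolding pieces_def by blast
qed

lemma pieces_cycle: "C \<in> pieces \<Longrightarrow> is_cycle C \<and> subgraph C G"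
  by (elim piecesE) (auto simp: row_cycle lowT_cycle upT_cycle row_subgraph lowT_subgraph upT_subgraph)

section \<open>The covering condition as equations between multiplicities\<close>

lemma size_dE:
  assumes "set_mset M \<subseteq> pieces"
  shows "size {#C \<in># M. dE i j \<in> edges C#} = count M (lowT i j) + count M (upT i j)"
proof -
  have "size {#C \<in># M. dE i j \<in> edges C#} = (\<Sum>C\<in>{lowT i j, upT i j}. count M C)"
  proof (rule size_filter_mset_eq_sum_count)
    fix C assume "C \<in># M" and e: "dE i j \<in> edges C"
    then have "C \<in> pieces" using assms by blast
    then show "C \<in> {lowT i j, upT i j}"
      using e by (elim piecesE)
        (auto simp: in_edges_row in_edges_lowT in_edges_upT lowT_eq_iff upT_eq_iff dvd_diff_commute)
  qed (auto simp: in_edges_lowT in_edges_upT)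
  then show ?thesis by (simp add: pieces_neq)
qed

lemma size_vE:
  assumes "set_mset M \<subseteq> pieces"
  shows "size {#C \<in># M. vE i j \<in> edges C#} = count M (lowT i (j - 1)) + count M (upT i j)"
proof -
  have "size {#C \<in># M. vE i j \<in> edges C#} = (\<Sum>C\<in>{lowT i (j - 1), upT i j}. count M C)"
  proof (rule size_filter_mset_eq_sum_count)
    fix C assume "C \<in># M" and e: "vE i j \<in> edges C"
    then have "C \<in> pieces" using assms by blast
    then show "C \<in> {lowT i (j - 1), upT i j}"
      using e by (elim piecesE)
        (auto simp: in_edges_row in_edges_lowT in_edges_upT lowT_eq_iff upT_eq_iff dvd_diff_commute
          algebra_simps)
  qed (auto simp: in_edges_lowT in_edges_upT)
  then show ?thesis by (simp add: pieces_neq)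
qed

text \<open>At \<open>i = l - 1\<close> the \<open>lowT\<close> term is 0, since no triangle beyond
  the last row is a piece. At \<open>i = 0\<close> there is no preceding band; the case distinction
  keeps the truncated \<open>i - 1\<close> from naming band \<open>0\<close> instead.\<close>

lemma size_hE:
  assumes "set_mset M \<subseteq> pieces"
  shows "size {#C \<in># M. hE i j \<in> edges C#} =
    count M (row i) + count M (lowT i j) + (if 0 < i then count M (upT (i - 1) j) else 0)"
proof -
  have "size {#C \<in># M. hE i j \<in> edges C#} =
    (\<Sum>C\<in>{row i, lowT i j} \<union> (if 0 < i then {upT (i - 1) j} else {}). count M C)"
  proof (rule size_filter_mset_eq_sum_count)
    fix C assume "C \<in># M" and e: "hE i j \<in> edges C"
    then have "C \<in> pieces" using assms by blast
    then show "C \<in> {row i, lowT i j} \<union> (if 0 < i then {upT (i - 1) j} else {})"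
      using e by (elim piecesE)
        (auto simp: in_edges_row in_edges_lowT in_edges_upT row_eq_iff lowT_eq_iff upT_eq_iff
          dvd_diff_commute)
  qed (auto simp: in_edges_row in_edges_lowT in_edges_upT split: if_splits)
  then show ?thesis by (auto simp: pieces_neq)
qed

text \<open>One equation per edge: slanted edges tie together the triangles of one band, row edges
  tie consecutive bands to the row between them.\<close>

lemma cdc_iff:
  assumes "set_mset M \<subseteq> pieces"
  shows "cycle_double_cover G M \<longleftrightarrow>
    (\<forall>i j. Suc i < l \<longrightarrow> count M (lowT i j) + count M (upT i j) = 2 \<and>
                        count M (lowT i (j - 1)) + count M (upT i j) = 2) \<and>
    (\<forall>i j. i < l \<longrightarrow>
       count M (row i) + count M (lowT i j) + (if 0 < i then count M (upT (i - 1) j) else 0) = 2)"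
  (is "_ \<longleftrightarrow> ?R")
proof -
  have "(\<forall>e\<in>edges G. size {#C \<in># M. e \<in> edges C#} = 2) \<longleftrightarrow>
     (\<forall>i j. Suc i < l \<longrightarrow> size {#C \<in># M. dE i j \<in> edges C#} = 2 \<and> size {#C \<in># M. vE i j \<in> edges C#} = 2) \<and>
     (\<forall>i j. i < l \<longrightarrow> size {#C \<in># M. hE i j \<in> edges C#} = 2)"
    unfolding G_def horizontal_def slanted_def snd_conv ball_Un ball_family by blast
  also have "\<dots> \<longleftrightarrow> ?R" by (simp add: size_dE[OF assms] size_vE[OF assms] size_hE[OF assms])
  finally show ?thesis
    using assms pieces_cycle unfolding cycle_double_cover_def by blast
qed

text \<open>The slanted edges bound the number of members that are not rows, which forces at least
  two rows; the total length then leaves no room for a further cycle longer than a triangle.\<close>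

lemma cdc_consists_of_pieces:
  assumes cdc: "cycle_double_cover G M" and sz: "size M = 2 * k * (l - 1) + 2"
  shows "set_mset M \<subseteq> pieces"
proof (rule ccontr)
  define isrow where "isrow C \<longleftrightarrow> (\<exists>i<l. C = row i)" for C
  define Rw where "Rw = filter_mset isrow M"
  define N where "N = filter_mset (\<lambda>C. \<not> isrow C) M"
  have M: "M = Rw + N" by (simp add: Rw_def N_def)
  have cyc: "is_cycle C" "edges C \<subseteq> horizontal \<union> slanted" if "C \<in># M" for C
    using cdc that by (auto simp: cycle_double_cover_def subgraph_def G_def)
  have ns: "edges C \<inter> slanted \<noteq> {}" if "C \<in># N" for C
  proof
    assume "edges C \<inter> slanted = {}"
    moreover have "C \<in># M" "\<not> isrow C" using that by (auto simp: N_def)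
    ultimately show False using flat_cycle_is_row cyc isrow_def by blast
  qed
  have tot: "(\<Sum>C\<in>#M. card (edges C \<inter> T)) = 2 * card T" if "T \<subseteq> horizontal \<union> slanted" "finite T" for T
  proof -
    have "(\<Sum>e\<in>T. size {#C \<in># M. e \<in> edges C#}) = (\<Sum>e\<in>T. 2)"
      using cdc that by (intro sum.cong) (auto simp: cycle_double_cover_def G_def)
    then show ?thesis using sum_mset_card_Int[OF that(2), of M] by simp
  qed
  \<comment> \<open>The slanted edges account for \<open>2 * card slanted\<close> incidences, and
    each member of \<open>N\<close> uses at least two of them.\<close>
  have "2 * size N \<le> (\<Sum>C\<in>#N. card (edges C \<inter> slanted))"
    using slanted_cycle_ge_2 cyc ns M by (intro sum_mset_ge_const) auto
  also have "\<dots> \<le> (\<Sum>C\<in>#M. card (edges C \<inter> slanted))" by (simp add: M)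
  also have "\<dots> = 2 * (2 * k * (l - 1))" using tot[of slanted] card_slanted by simp
  finally have "size N \<le> 2 * k * (l - 1)" by simp
  \<comment> \<open>\<open>g\<close> is the number of rows in the cover beyond the first
    two.\<close>
  then obtain g where g: "size Rw = 2 + g" using sz M by (metis add.commute add_le_cancel_left le_iff_add size_union)
  have "(\<Sum>C\<in>#M. card (edges C)) = (\<Sum>C\<in>#M. card (edges C \<inter> (horizontal \<union> slanted)))"
    using cyc by (intro arg_cong[where f = sum_mset] image_mset_cong) (simp add: Int_absorb2)
  also have "\<dots> = 2 * card (horizontal \<union> slanted)"
    using tot card_horizontal card_slanted by blast
  also have "card (horizontal \<union> slanted) = l * k + 2 * k * (l - 1)"
    using card_horizontal card_slanted horizontal_slanted_disjoint by (simp add: card_Un_disjoint)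
  finally have all: "(\<Sum>C\<in>#M. card (edges C)) = 2 * (l * k + 2 * k * (l - 1))" .
  have "(\<Sum>C\<in>#Rw. card (edges C)) = (\<Sum>C\<in>#Rw. k)"
    by (intro arg_cong[where f = sum_mset] image_mset_cong) (auto simp: Rw_def isrow_def card_row)
  then have rows: "(\<Sum>C\<in>#Rw. card (edges C)) = k * size Rw" by simp
  assume "\<not> set_mset M \<subseteq> pieces"
  then obtain C where C: "C \<in># M" "C \<notin> pieces" by blast
  then have "\<not> isrow C" by (auto simp: isrow_def pieces_def)
  then have CN: "C \<in># N" using C by (simp add: N_def)
  \<comment> \<open>A triangle with a slanted edge is a piece, so the offending cycle has length at
    least 4. This is the source of the \<open>+ 1\<close> below.\<close>
  have "card (edges C) \<noteq> 3"
    using slanted_triangle[of C] cyc[OF C(1)] ns[OF CN] C(2) pieces_iff by metis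
  then have C4: "4 \<le> card (edges C)" using cycle_card_ge_3[OF cyc(1)[OF C(1)]] by simp
  obtain N' where N': "N = add_mset C N'" using CN by (meson mset_add)
  have "3 * size N' \<le> (\<Sum>C\<in>#N'. card (edges C))"
    using cycle_card_ge_3 cyc M N' by (intro sum_mset_ge_const) auto
  then have "3 * size N + 1 \<le> (\<Sum>C\<in>#N. card (edges C))" using C4 N' by simp
  then have len: "k * (2 + g) + 3 * size N + 1 \<le> 2 * (l * k + 2 * k * (l - 1))"
    using all rows M g by simp
  obtain m where m: "l = Suc m" using l2 by (cases l) auto
  \<comment> \<open>With \<open>l = m + 1\<close> the contribution \<open>2 * k\<close> of the first
    two rows cancels. As \<open>size N + g = 2 * (k * m)\<close> and
    \<open>3 * g \<le> k * g\<close>, the left side is at least \<open>6 * (k * m) + 1\<close>,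
    which is the contradiction.\<close>
  have "k * g + 3 * size N + 1 \<le> 6 * (k * m)"
    using len by (simp add: m algebra_simps)
  moreover have "size N + g = 2 * (k * m)" using sz M g by (simp add: m)
  moreover have "3 * g \<le> k * g" using k3 by simp
  ultimately show False by linarith
qed

section \<open>The covers determined by a pair of rows\<close>

definition mult :: "nat \<Rightarrow> nat \<Rightarrow> nat \<Rightarrow> nat" where
  "mult a b i = of_bool (i < a) + of_bool (i < b)"

text \<open>Band \<open>i\<close> lies between rows \<open>i\<close> and \<open>i + 1\<close>. For
  \<open>a \<le> b\<close> its lower triangles occur twice before row \<open>a\<close>, once between
  rows \<open>a\<close> and \<open>b\<close>, and not at all from row \<open>b\<close> on; the upper
  triangles are complementary.\<close>

definition cover :: "nat \<Rightarrow> nat \<Rightarrow> 'a ugraph multiset" where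
  "cover a b = {#row a, row b#} + (\<Sum>(i, j)\<in>{..<l - 1} \<times> {0..<int k}.
     replicate_mset (mult a b i) (lowT i j) + replicate_mset (2 - mult a b i) (upT i j))"

text \<open>Exactly one index in a period is congruent to \<open>j'\<close>. This evaluates the
  multiplicity of a single triangle in \<open>cover\<close>.\<close>

lemma sum_delta_periodic:
  fixes f :: "nat \<Rightarrow> nat"
  shows "(\<Sum>(i, j)\<in>{..<l - 1} \<times> {0..<int k}. if i = i' \<and> int k dvd j - j' then f i else 0) =
    (if Suc i' < l then f i' else 0)"
proof -
  have *: "int k dvd j - j' \<longleftrightarrow> j = j' mod int k" if "j \<in> {0..<int k}" for j
  proof -
    have "int k dvd j - j' \<longleftrightarrow> int k dvd j - j' mod int k"
      by (metis mod_eq_dvd_iff mod_mod_trivial)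
    then show ?thesis using residue_eq_iff that mod_k_bounds by simp
  qed
  have "(\<Sum>(i, j)\<in>{..<l - 1} \<times> {0..<int k}. if i = i' \<and> int k dvd j - j' then f i else 0) =
     (\<Sum>x\<in>{..<l - 1} \<times> {0..<int k}. if x = (i', j' mod int k) then f i' else 0)"
  proof (rule sum.cong)
    fix x assume "x \<in> {..<l - 1} \<times> {0..<int k}"
    then obtain i j where "x = (i, j)" "j \<in> {0..<int k}" by blast
    then show "(case x of (i, j) \<Rightarrow> if i = i' \<and> int k dvd j - j' then f i else 0) =
        (if x = (i', j' mod int k) then f i' else 0)"
      using *[of j] by auto
  qed simp
  also have "\<dots> = (if Suc i' < l then f i' else 0)"
    using mod_k_bounds[of j'] by (subst sum.delta) auto
  finally show ?thesis .
qed

lemma count_cover_row: "count (cover a b) (row i) = of_bool (i = a) + of_bool (i = b)"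
proof -
  have "count (cover a b) (row i) = count {#row a, row b#} (row i)"
    by (simp add: cover_def count_sum case_prod_beta pieces_neq)
  then show ?thesis by (auto simp: row_eq_iff)
qed

lemma count_cover_lowT: "count (cover a b) (lowT i j) = (if Suc i < l then mult a b i else 0)"
proof -
  have "count (cover a b) (lowT i j) =
      (\<Sum>(i', j')\<in>{..<l - 1} \<times> {0..<int k}. if i' = i \<and> int k dvd j' - j then mult a b i' else 0)"
    unfolding cover_def
    by (auto simp: count_sum case_prod_beta pieces_neq lowT_eq_iff dvd_diff_commute intro!: sum.cong)
  then show ?thesis by (simp only: sum_delta_periodic)
qed

lemma count_cover_upT: "count (cover a b) (upT i j) = (if Suc i < l then 2 - mult a b i else 0)"
proof -
  have "count (cover a b) (upT i j) =
      (\<Sum>(i', j')\<in>{..<l - 1} \<times> {0..<int k}. if i' = i \<and> int k dvd j' - j then 2 - mult a b i' else 0)"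
    unfolding cover_def
    by (auto simp: count_sum case_prod_beta pieces_neq upT_eq_iff dvd_diff_commute intro!: sum.cong)
  then show ?thesis by (simp only: sum_delta_periodic)
qed

lemma cover_pieces:
  assumes "a < l" "b < l"
  shows "set_mset (cover a b) \<subseteq> pieces"
proof -
  have "set_mset (replicate_mset (mult a b i) (lowT i j) + replicate_mset (2 - mult a b i) (upT i j)) \<subseteq> pieces"
    if "i < l - 1" for i j
    using that by (auto simp: pieces_iff in_replicate_mset)
  then show ?thesis
    unfolding cover_def using assms by (auto simp: set_mset_sum pieces_iff simp del: set_mset_union)
qed

lemma mult_le_2: "mult a b i \<le> 2"
  by (simp add: mult_def of_bool_def)

text \<open>The two triangles at \<open>(i, j)\<close> together contribute 2, whatever
  \<open>a\<close> and \<open>b\<close> are.\<close>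

lemma size_cover: "size (cover a b) = 2 * k * (l - 1) + 2"
proof -
  have "size (cover a b) = 2 + (\<Sum>(i, j)\<in>{..<l - 1} \<times> {0..<int k}. mult a b i + (2 - mult a b i))"
    by (simp add: cover_def case_prod_beta)
  also have "\<dots> = 2 + (\<Sum>(i, j)\<in>{..<l - 1} \<times> {0..<int k}. 2)"
    by (simp only: le_add_diff_inverse mult_le_2)
  finally show ?thesis by simp
qed

lemma cover_cdc:
  assumes "a \<le> b" "b < l"
  shows "cycle_double_cover G (cover a b)"
proof -
  \<comment> \<open>In passing row \<open>i\<close>, \<open>mult\<close> drops by the number of
    \<open>a\<close>, \<open>b\<close> equal to \<open>i\<close>, and the copies of the row make up
    for it. Row \<open>0\<close> behaves as if preceded by a band of multiplicity 2, row
    \<open>l - 1\<close> as if followed by one of multiplicity 0.\<close>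
  have eq: "of_bool (i = a) + of_bool (i = b) + (if Suc i < l then mult a b i else 0)
      + (if 0 < i then 2 - mult a b (i - 1) else 0) = 2" if "i < l" for i
    using that assms by (cases i) (auto simp: mult_def of_bool_def)
  have up: "(if 0 < i then count (cover a b) (upT (i - 1) j) else 0) =
      (if 0 < i then 2 - mult a b (i - 1) else 0)" if "i < l" for i j
    using that by (simp add: count_cover_upT)
  have "count (cover a b) (row i) + count (cover a b) (lowT i j)
      + (if 0 < i then count (cover a b) (upT (i - 1) j) else 0) = 2" if "i < l" for i j
    using eq[OF that] by (simp only: count_cover_row count_cover_lowT up[OF that])
  moreover have "count (cover a b) (lowT i j) + count (cover a b) (upT i j') = 2" if "Suc i < l" for i j j'
    unfolding count_cover_lowT count_cover_upT using that mult_le_2 by simp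
  moreover have "set_mset (cover a b) \<subseteq> pieces" using cover_pieces assms by simp
  ultimately show ?thesis using cdc_iff by blast
qed

text \<open>The two slanted edges of an upper triangle equate the multiplicities of the lower
  triangles on either side, so each band has one multiplicity \<open>y i\<close>. The rows of the
  cover sit where \<open>y\<close> drops.\<close>

lemma cdc_is_cover:
  assumes cdc: "cycle_double_cover G M" and sz: "size M = 2 * k * (l - 1) + 2"
  shows "\<exists>a b. a \<le> b \<and> b < l \<and> M = cover a b"
proof -
  have P: "set_mset M \<subseteq> pieces" by (rule cdc_consists_of_pieces[OF assms])
  note eqs = cdc[unfolded cdc_iff[OF P]]
  define y where "y i = count M (lowT i 0)" for i
  \<comment> \<open>Triangles beyond the last row do not occur, so \<open>y\<close> vanishes from
    \<open>l - 1\<close> on; this default serves as the end value.\<close>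
  have out: "count M (lowT i j) = 0" if "\<not> Suc i < l" for i j
    using P that pieces_iff(2) by (metis count_eq_zero_iff subsetD)
  have low: "count M (lowT i j) = y i" for i j
  proof (cases "Suc i < l")
    case True
    then have *: "count M (lowT i (j - 1)) = count M (lowT i j)" for j
      using eqs by (metis add_right_cancel)
    have **: "count M (lowT i (j + 1)) = count M (lowT i j)" for j using *[of "j + 1"] by simp
    show ?thesis
    proof (rule int_shift_induct[where P = "\<lambda>j. count M (lowT i j) = y i" and ?j0.0 = 0])
      show "count M (lowT i 0) = y i" by (simp add: y_def)
    qed (simp_all only: * **)
  qed (simp add: out y_def)
  have y0: "y i = 0" if "\<not> Suc i < l" for i using out that by (simp add: y_def)
  have up: "y i + count M (upT i j) = 2" if "Suc i < l" for i j
    using eqs that by (simp add: low)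
  have row: "count M (row i) + y i + (if 0 < i then 2 - y (i - 1) else 0) = 2" if "i < l" for i
  proof (cases "0 < i")
    case True
    then have "count M (row i) + y i + count M (upT (i - 1) 0) = 2" using eqs that unfolding low by auto
    moreover have "y (i - 1) + count M (upT (i - 1) 0) = 2" using up[of "i - 1" 0] True that by simp
    ultimately show ?thesis using True by simp
  qed (use eqs that in \<open>auto simp: low\<close>)
  have y2: "y i \<le> 2" for i using up y0 by (metis le_add1 zero_le)
  \<comment> \<open>Since \<open>y i \<le> 2\<close>, the truncated subtraction in
    \<open>row\<close> is exact, and the multiplicity of row \<open>Suc i\<close> is the drop
    \<open>y i - y (Suc i)\<close>.\<close>
  have dec1: "y (Suc i) \<le> y i" for i
    using row[of "Suc i"] y0[of "Suc i"] y2[of i] by (cases "Suc i < l") auto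
  have dec: "y i' \<le> y i" if "i \<le> i'" for i i'
    using lift_Suc_antimono_le[of y, OF dec1 that] .
  \<comment> \<open>The first bands with multiplicity below 2 and below 1. Both exist and are at
    most \<open>l - 1\<close>, because \<open>y (l - 1) = 0\<close>.\<close>
  define a where "a = (LEAST i. y i < 2)"
  define b where "b = (LEAST i. y i < 1)"
  have yl: "y (l - 1) = 0" using y0 l2 by simp
  have "y a < 2" unfolding a_def by (rule LeastI[of _ "l - 1"]) (use yl in simp)
  have "y b < 1" unfolding b_def by (rule LeastI[of _ "l - 1"]) (use yl in simp)
  have "a \<le> b" unfolding a_def by (rule Least_le) (use \<open>y b < 1\<close> in simp)
  have "b \<le> l - 1" unfolding b_def by (rule Least_le) (use yl in simp)
  then have "b < l" using l2 by simp
  \<comment> \<open>A nonincreasing sequence with values in 0, 1, 2 is determined by these two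
    thresholds.\<close>
  have ym: "y i = mult a b i" for i
  proof -
    have 1: "i < a \<longleftrightarrow> \<not> y i < 2" for i
      using dec[of a i] \<open>y a < 2\<close> not_less_Least[of i "\<lambda>i. y i < 2"] unfolding a_def[symmetric] by force
    have 2: "i < b \<longleftrightarrow> \<not> y i < 1" for i
      using dec[of b i] \<open>y b < 1\<close> not_less_Least[of i "\<lambda>i. y i < 1"] unfolding b_def[symmetric] by force
    show ?thesis using 1[of i] 2[of i] y2[of i] by (auto simp: mult_def)
  qed
  have "M = cover a b"
  proof (rule multiset_eqI)
    fix C
    show "count M C = count (cover a b) C"
    proof (cases "C \<in> pieces")
      case True
      then show ?thesis
      proof (cases rule: piecesE)
        case (1 i)
        then show ?thesis using row[of i] \<open>a \<le> b\<close>
          by (auto simp: count_cover_row ym mult_def of_bool_def split: if_splits)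
      next
        case (2 i j)
        then show ?thesis by (simp add: count_cover_lowT low ym)
      next
        case (3 i j)
        then show ?thesis using up[of i j] by (simp add: count_cover_upT ym)
      qed
    next
      case False
      then have "C \<notin># M" "C \<notin># cover a b" using P cover_pieces[of a b] \<open>a \<le> b\<close> \<open>b < l\<close> by auto
      then show ?thesis by (simp add: not_in_iff)
    qed
  qed
  then show ?thesis using \<open>a \<le> b\<close> \<open>b < l\<close> by blast
qed

text \<open>The multiplicities of the rows recover the two indices, and \<open>a \<le> b\<close>
  fixes their order.\<close>

lemma cover_inj:
  assumes "cover a b = cover a' b'" "a \<le> b" "a' \<le> b'"
  shows "a = a' \<and> b = b'"
proof -
  have eq: "of_bool (i = a) + of_bool (i = b) = (of_bool (i = a') + of_bool (i = b') :: nat)" for i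
    using assms(1) count_cover_row by metis
  have "i \<in> {a, b} \<longleftrightarrow> i \<in> {a', b'}" for i
    using eq[of i] by (auto simp: of_bool_def split: if_splits)
  then have "{a, b} = {a', b'}" by blast
  then show ?thesis using assms(2,3) by (auto simp: doubleton_eq_iff)
qed

text \<open>The pair is written \<open>(b, a)\<close> so that the range of \<open>a\<close> depends
  on \<open>b\<close>; the cardinality is then the sum of 1 to \<open>l\<close>.\<close>

lemma cdcs_eq:
  "{M. cycle_double_cover G M \<and> size M = 2 * k * (l - 1) + 2} =
     (\<lambda>(b, a). cover a b) ` (SIGMA b:{..<l}. {..b})"
  (is "?L = ?R")
proof
  show "?L \<subseteq> ?R"
  proof
    fix M assume "M \<in> ?L"
    then obtain a b where "a \<le> b" "b < l" "M = cover a b" using cdc_is_cover by blast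
    then show "M \<in> ?R" by (auto intro!: image_eqI[of _ _ "(b, a)"])
  qed
  show "?R \<subseteq> ?L" using cover_cdc size_cover by auto
qed

lemma num_cdc_G: "num_cdc G (2 * k * (l - 1) + 2) = l * (l + 1) div 2"
proof -
  have "inj_on (\<lambda>(b, a). cover a b) (SIGMA b:{..<l}. {..b})"
    using cover_inj by (auto simp: inj_on_def)
  then have "num_cdc G (2 * k * (l - 1) + 2) = card (SIGMA b:{..<l}. {..b})"
    unfolding num_cdc_def cdcs_eq by (rule card_image)
  also have "\<dots> = (\<Sum>b<l. Suc b)" by simp
  also have "\<dots> = l * (l + 1) div 2" by (induction l) auto
  finally show ?thesis .
qed

text \<open>The lower triangles of the first band occur at most once only if \<open>a = 0\<close>,
  the upper triangles of the last band only if \<open>b = l - 1\<close>. For this pair every band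
  has \<open>mult\<close> equal to 1, and the two rows differ because
  \<open>2 \<le> l\<close>.\<close>

lemma cover_true_iff:
  assumes "a \<le> b" "b < l"
  shows "(\<forall>C. count (cover a b) C \<le> 1) \<longleftrightarrow> a = 0 \<and> b = l - 1"
proof
  assume *: "\<forall>C. count (cover a b) C \<le> 1"
  have m: "mult a b i \<le> 1" "2 - mult a b i \<le> 1" if "Suc i < l" for i
    using *[rule_format, of "lowT i 0"] *[rule_format, of "upT i 0"] that
    by (simp_all add: count_cover_lowT count_cover_upT)
  have "Suc 0 < l" "Suc (l - 2) < l" using l2 by auto
  then have "mult a b 0 \<le> 1" "2 - mult a b (l - 2) \<le> 1" using m by blast+
  then show "a = 0 \<and> b = l - 1"
    using assms by (auto simp: mult_def of_bool_def split: if_splits)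
next
  assume ab: "a = 0 \<and> b = l - 1"
  show "\<forall>C. count (cover a b) C \<le> 1"
  proof
    fix C
    show "count (cover a b) C \<le> 1"
    proof (cases "C \<in> pieces")
      case True
      then show ?thesis
        by (cases rule: piecesE)
          (use ab l2 in \<open>auto simp: count_cover_row count_cover_lowT count_cover_upT mult_def\<close>)
    next
      case False
      then have "C \<notin># cover a b" using cover_pieces[of a b] assms by auto
      then show ?thesis by (simp add: not_in_iff)
    qed
  qed
qed

lemma num_true_cdc_G: "num_true_cdc G (2 * k * (l - 1) + 2) = 1"
proof -
  have "0 \<le> l - 1" "l - 1 < l" using l2 by auto
  then have "{M. true_cycle_double_cover G M \<and> size M = 2 * k * (l - 1) + 2} = {cover 0 (l - 1)}"
    using cdc_is_cover cover_cdc size_cover cover_true_iff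
    unfolding true_cycle_double_cover_def by blast
  then show ?thesis by (simp add: num_true_cdc_def)
qed

end

section \<open>Connectivity\<close>

lemma graph_adj_delete_verts:
  "graph_adj (delete_verts H X) u v \<longleftrightarrow> {u, v} \<in> edges H \<and> u \<notin> X \<and> v \<notin> X"
  by (auto simp: graph_adj_def delete_verts_def)

lemma graph_reach_sym: "(graph_adj H)\<^sup>*\<^sup>* u v \<Longrightarrow> (graph_adj H)\<^sup>*\<^sup>* v u"
proof -
  have "symp (graph_adj H)" by (auto simp: symp_def graph_adj_def insert_commute)
  then show "(graph_adj H)\<^sup>*\<^sup>* u v \<Longrightarrow> (graph_adj H)\<^sup>*\<^sup>* v u"
    using symp_rtranclp sympD by metis
qed

lemma graph_connectedI:
  assumes "r \<in> verts H" and "\<And>v. v \<in> verts H \<Longrightarrow> (graph_adj H)\<^sup>*\<^sup>* v r"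
  shows "graph_connected H"
  unfolding graph_connected_def using assms graph_reach_sym by (metis empty_iff rtranclp_trans)

lemma card_Int_le_1E:
  assumes "finite X" "card (X \<inter> R) \<le> 1" "a \<in> R" "b \<in> R" "a \<noteq> b"
  shows "a \<notin> X \<or> b \<notin> X"
proof (rule ccontr)
  assume "\<not> ?thesis"
  then have "card {a, b} \<le> card (X \<inter> R)" using assms by (intro card_mono) auto
  then show False using assms by simp
qed

context cylinder_grid
begin

text \<open>A row with at most one vertex deleted is still connected: it is walked once around,
  starting just after the deleted vertex.\<close>

lemma row_reach:
  assumes X: "finite X" "card (X \<inter> range (p i)) \<le> 1" and i: "i < l"
    and "p i j \<notin> X" "p i j' \<notin> X"
  shows "(graph_adj (delete_verts G X))\<^sup>*\<^sup>* (p i j) (p i j')"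
proof -
  let ?H = "delete_verts G X"
  \<comment> \<open>The column of the deleted vertex; if the row is intact, any column will
    do.\<close>
  obtain m where m: "X \<inter> range (p i) \<subseteq> {p i m}"
  proof (cases "X \<inter> range (p i) = {}")
    case False
    then obtain m where "p i m \<in> X" by blast
    then have "X \<inter> range (p i) \<subseteq> {p i m}" using card_Int_le_1E[OF X] by blast
    then show ?thesis using that by blast
  qed (use that in blast)
  have path: "(graph_adj ?H)\<^sup>*\<^sup>* (p i (m + 1)) (p i (m + 1 + int n))"
    if "\<forall>n'\<le>n. p i (m + 1 + int n') \<notin> X" for n
    using that
  proof (induction n)
    case (Suc n)
    have "hE i (m + 1 + int n) \<in> edges G" using i by (rule hE_in_G)
    then have "graph_adj ?H (p i (m + 1 + int n)) (p i (m + 1 + int (Suc n)))"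
      using Suc.prems[rule_format, of n] Suc.prems[rule_format, of "Suc n"]
      by (simp add: graph_adj_delete_verts hE_def algebra_simps)
    then show ?case using Suc by (meson le_SucI rtranclp.rtrancl_into_rtrancl)
  qed simp
  have all: "(graph_adj ?H)\<^sup>*\<^sup>* (p i (m + 1)) (p i j)" if j: "p i j \<notin> X" for j
  proof -
    define n where "n = nat ((j - m - 1) mod int k)"
    have n: "int n = (j - m - 1) mod int k" "n < k"
      using k3 by (auto simp: n_def nat_less_iff)
    have "int k dvd j - (m + 1 + int n)"
      unfolding n(1) using mod_k_dvd(1)[of "j - m - 1"] by (simp add: algebra_simps)
    then have pj: "p i j = p i (m + 1 + int n)" by (simp add: p_eq_iff)
    \<comment> \<open>The walk can meet \<open>X\<close> only on returning to column
      \<open>m\<close>, that is at \<open>n' = k - 1\<close>. As \<open>n' \<le> n < k\<close>, this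
      would be the target itself, which is not deleted.\<close>
    have "p i (m + 1 + int n') \<notin> X" if "n' \<le> n" for n'
    proof
      assume x: "p i (m + 1 + int n') \<in> X"
      then have "p i (m + 1 + int n') = p i m" using m by blast
      then have "int k dvd int (Suc n')" by (simp add: p_eq_iff algebra_simps)
      then have "k dvd Suc n'" by (simp only: int_dvd_int_iff)
      then have "k \<le> Suc n'" by (rule dvd_imp_le) simp
      then have "n' = n" using that n by simp
      then show False using x j pj by simp
    qed
    then show ?thesis using path pj by simp
  qed
  show ?thesis using all graph_reach_sym assms by (meson rtranclp_trans)
qed

text \<open>Pigeonhole: one deleted vertex from each column would give \<open>k\<close> different
  members of \<open>X\<close>.\<close>

lemma column_avoiding:
  assumes "finite X" "card X < k"
  shows "\<exists>c. \<forall>i. p i c \<notin> X"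
proof (rule ccontr)
  assume "\<not> ?thesis"
  then obtain f where f: "\<And>c. p (f c) c \<in> X" by metis
  have "inj_on (\<lambda>c. p (f c) c) {0..<int k}"
    by (auto simp: inj_on_def p_eq_iff residue_eq_iff)
  then have "card {0..<int k} \<le> card X"
    by (rule card_inj_on_le) (use f assms in auto)
  then show False using assms by simp
qed

lemma column_reach:
  assumes "\<And>i. p i c \<notin> X" "i < l"
  shows "(graph_adj (delete_verts G X))\<^sup>*\<^sup>* (p 0 c) (p i c)"
  using assms(2)
proof (induction i)
  case (Suc i)
  then have "graph_adj (delete_verts G X) (p i c) (p (Suc i) c)"
    using vE_in_G[of i c] assms(1) by (simp add: graph_adj_delete_verts vE_def)
  then show ?case using Suc by (meson Suc_lessD rtranclp.rtrancl_into_rtrancl)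
qed simp

text \<open>Both neighbours lie in the same adjacent row, so one deletion in that row cannot block
  both. The next row is used if there is one, otherwise the preceding row, which exists by
  \<open>2 \<le> l\<close>.\<close>

lemma two_neighbours:
  assumes "i < l"
  obtains i' j1 j2 where "i' < l" "i' \<noteq> i" "p i' j1 \<noteq> p i' j2"
    "{p i j, p i' j1} \<in> edges G" "{p i j, p i' j2} \<in> edges G"
proof (cases "Suc i < l")
  case True
  then show ?thesis
    using that[of "Suc i" j "j + 1"] vE_in_G[of i j] dE_in_G[of i j] p_neq
    by (simp add: vE_def dE_def)
next
  case False
  then obtain i' where i': "i = Suc i'" "i' < l" using assms l2 by (cases i) auto
  then show ?thesis
    using that[of i' j "j - 1"] vE_in_G[of i' j] dE_in_G[of i' "j - 1"] p_neq assms
    by (simp add: vE_def dE_def insert_commute)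
qed

lemma step_to_sparse_row:
  assumes X: "finite X" and i: "i < l" and v: "p i j \<notin> X"
    and sparse: "\<And>i'. i' < l \<Longrightarrow> i' \<noteq> i \<Longrightarrow> card (X \<inter> range (p i')) \<le> 1"
  obtains i' j' where "i' < l" "i' \<noteq> i" "p i' j' \<notin> X" "graph_adj (delete_verts G X) (p i j) (p i' j')"
proof -
  obtain i' j1 j2 where n: "i' < l" "i' \<noteq> i" "p i' j1 \<noteq> p i' j2"
    "{p i j, p i' j1} \<in> edges G" "{p i j, p i' j2} \<in> edges G"
    using two_neighbours[OF i] by metis
  have "p i' j1 \<notin> X \<or> p i' j2 \<notin> X" using card_Int_le_1E[OF X sparse] n by blast
  then show ?thesis using that n v by (auto simp: graph_adj_delete_verts)
qed

text \<open>If one row takes two of at most three deletions, at most one is left for any other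
  row.\<close>

lemma other_rows_sparse:
  assumes X: "finite X" "card X \<le> 3" and "\<not> card (X \<inter> range (p i)) \<le> 1" "i' \<noteq> i"
  shows "card (X \<inter> range (p i')) \<le> 1"
proof -
  have "card (X \<inter> range (p i)) + card (X \<inter> range (p i')) = card ((X \<inter> range (p i)) \<union> (X \<inter> range (p i')))"
    using X \<open>i' \<noteq> i\<close> by (intro card_Un_disjoint[symmetric]) (auto simp: p_eq_iff)
  also have "\<dots> \<le> card X" using X by (intro card_mono) auto
  finally show ?thesis using assms by simp
qed

lemma vertexE:
  assumes "v \<in> verts (delete_verts G X)"
  obtains i j where "i < l" "v = p i j" "p i j \<notin> X"
  using assms by (auto simp: delete_verts_def G_def V_def)

text \<open>An intact column links all rows. A row with at most one deletion reaches it from within;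
  at most one row has more deletions, and each of its surviving vertices can step into an adjacent
  row.\<close>

lemma connected_if_few_deleted:
  assumes X: "finite X" "card X \<le> 3" "card X < k"
  shows "graph_connected (delete_verts G X)"
proof -
  let ?H = "delete_verts G X"
  obtain c where c: "\<And>i. p i c \<notin> X" using column_avoiding X by blast
  have sparse: "(graph_adj ?H)\<^sup>*\<^sup>* (p i j) (p 0 c)"
    if "i < l" "p i j \<notin> X" "card (X \<inter> range (p i)) \<le> 1" for i j
    using row_reach[OF X(1) that(3,1,2) c] graph_reach_sym[OF column_reach[of c X i, OF c that(1)]]
    by (rule rtranclp_trans)
  show ?thesis
  proof (rule graph_connectedI)
    show "p 0 c \<in> verts ?H" using c l2 by (auto simp: delete_verts_def G_def V_def)
    fix v assume "v \<in> verts ?H"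
    then obtain i j where v: "i < l" "v = p i j" "p i j \<notin> X" by (rule vertexE)
    show "(graph_adj ?H)\<^sup>*\<^sup>* v (p 0 c)"
    proof (cases "card (X \<inter> range (p i)) \<le> 1")
      case True
      then show ?thesis using sparse v by blast
    next
      case False
      note sp = other_rows_sparse[OF X(1,2) False]
      obtain i' j' where "i' < l" "i' \<noteq> i" "p i' j' \<notin> X" "graph_adj ?H (p i j) (p i' j')"
        using step_to_sparse_row[OF X(1) v(1,3) sp] by metis
      then show ?thesis using sparse sp v by (meson converse_rtranclp_into_rtranclp)
    qed
  qed
qed

text \<open>Three deletions can hit every column when \<open>k = 3\<close>. With only two rows, one
  with at most one deletion takes over as the hub, since every surviving vertex of the other row has
  a surviving neighbour in it.\<close>

lemma connected_two_rows:
  assumes X: "finite X" "card X \<le> 3" and l: "l = 2"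
  shows "graph_connected (delete_verts G X)"
proof -
  let ?H = "delete_verts G X"
  obtain r where r: "r < l" "card (X \<inter> range (p r)) \<le> 1"
  proof (cases "card (X \<inter> range (p 0)) \<le> 1")
    case False
    then show ?thesis using other_rows_sparse[OF X False, of 1] l that[of 1] by simp
  qed (use that[of 0] l in simp)
  have "p r 0 \<notin> X \<or> p r 1 \<notin> X"
    using card_Int_le_1E[OF X(1) r(2), of "p r 0" "p r 1"] p_neq(1)[of r 0] by simp
  then obtain c where c: "p r c \<notin> X" by blast
  show ?thesis
  proof (rule graph_connectedI)
    show "p r c \<in> verts ?H" using c r by (auto simp: delete_verts_def G_def V_def)
    fix v assume "v \<in> verts ?H"
    then obtain i j where v: "i < l" "v = p i j" "p i j \<notin> X" by (rule vertexE)
    show "(graph_adj ?H)\<^sup>*\<^sup>* v (p r c)"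
    proof (cases "i = r")
      case True
      then show ?thesis using row_reach[OF X(1) r(2,1)] v c by blast
    next
      case False
      then have other: "i' = r" if "i' < l" "i' \<noteq> i" for i' using that v(1) r(1) l by linarith
      obtain i' j' where *: "i' < l" "i' \<noteq> i" "p i' j' \<notin> X" "graph_adj ?H (p i j) (p i' j')"
        using step_to_sparse_row[OF X(1) v(1,3)] other r(2) by metis
      then have "i' = r" using other by blast
      then have "(graph_adj ?H)\<^sup>*\<^sup>* (p i' j') (p r c)" using row_reach[OF X(1) r(2,1)] * c by blast
      then show ?thesis using * v by (meson converse_rtranclp_into_rtranclp)
    qed
  qed
qed

lemma k_connected_G: "if k = 3 \<and> l \<ge> 3 then k_connected 3 G else k_connected 4 G"
proof -
  have "3 * 2 \<le> k * l" using k3 l2 by (intro mult_le_mono)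
  then have cV: "4 < card (verts G)" by (simp add: G_def card_V mult.commute)
  have fin: "finite X" if "X \<subseteq> verts G" for X
    using that finite_V finite_subset by (auto simp: G_def)
  show ?thesis
  proof (cases "k = 3 \<and> l \<ge> 3")
    case True
    have "graph_connected (delete_verts G X)" if "X \<subseteq> verts G" "card X < 3" for X
      by (rule connected_if_few_deleted) (use that fin True in auto)
    then show ?thesis using True cV by (simp add: k_connected_def)
  next
    case False
    \<comment> \<open>Either an intact column survives three deletions, or the argument for two rows
      applies.\<close>
    then have "4 \<le> k \<or> l = 2" using k3 l2 by linarith
    then have "graph_connected (delete_verts G X)" if "X \<subseteq> verts G" "card X < 4" for X
      using connected_if_few_deleted[of X] connected_two_rows[of X] that fin by fastforce
    then show ?thesis using False cV by (auto simp: k_connected_def)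
  qed
qed

lemma graph_connected_G: "graph_connected G"
  using connected_if_few_deleted[of "{}"] k3 by (simp add: delete_verts_def)

end

section \<open>The plane drawing\<close>

text \<open>Each member is open and so is the union of the others, so a connected subset of the
  union containing a member cannot leave it. The faces are read off from such a partition of the
  complement.\<close>

lemma components_Union_disjoint_open:
  fixes F :: "'a::topological_space set set"
  assumes F: "\<And>S. S \<in> F \<Longrightarrow> open S \<and> connected S \<and> S \<noteq> {}"
    and disj: "\<And>S T. S \<in> F \<Longrightarrow> T \<in> F \<Longrightarrow> S \<noteq> T \<Longrightarrow> S \<inter> T = {}"
  shows "components (\<Union>F) = F"
proof -
  have sub: "S \<in> components (\<Union>F)" if S: "S \<in> F" for S
    unfolding in_components_maximal
  proof (intro conjI allI impI)
    show "S \<noteq> {}" "S \<subseteq> \<Union>F" "connected S" using S F by auto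
    fix D assume D: "D \<noteq> {} \<and> S \<subseteq> D \<and> D \<subseteq> \<Union>F \<and> connected D"
    have "D \<inter> \<Union>(F - {S}) = {}"
    proof (rule ccontr)
      assume "D \<inter> \<Union>(F - {S}) \<noteq> {}"
      moreover have "open (\<Union>(F - {S}))" using F by blast
      moreover have "S \<inter> \<Union>(F - {S}) = {}" using disj S by blast
      moreover have "D \<subseteq> S \<union> \<Union>(F - {S})" using D by blast
      moreover have "S \<inter> D \<noteq> {}" using D S F by blast
      ultimately show False
        using connectedD[of D S "\<Union>(F - {S})"] D S F by blast
    qed
    then show "D = S" using D by blast
  qed
  moreover have "C \<in> F" if C: "C \<in> components (\<Union>F)" for C
  proof -
    obtain x where "x \<in> C" "x \<in> \<Union>F"
      using in_components_nonempty[OF C] in_components_subset[OF C] by blast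
    then obtain S where "S \<in> F" "C \<inter> S \<noteq> {}" by blast
    then have "C = S" using components_nonoverlap[OF C sub] by blast
    then show ?thesis using \<open>S \<in> F\<close> by simp
  qed
  ultimately show ?thesis by blast
qed

section \<open>Integer parts and the wrapping map\<close>

lemma of_int_add_frac_eq:
  fixes a b :: int and t t' :: real
  assumes "of_int a + t = of_int b + t'" "0 \<le> t" "t < 1" "0 \<le> t'" "t' < 1"
  shows "a = b \<and> t = t'"
proof -
  have "real_of_int a < of_int (b + 1)" "real_of_int b < of_int (a + 1)" using assms by simp_all
  then have "a = b" by linarith
  then show ?thesis using assms(1) by (metis add_left_cancel)
qed

lemma not_Ints_between:
  fixes x :: real
  assumes "of_int a < x" "x < of_int a + 1"
  shows "x \<notin> \<int>"
  using assms by (metis Ints_cases less_irrefl of_int_1 of_int_add of_int_less_iff zless_add1_eq order.asym)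

text \<open>An exponential with real period \<open>k\<close> (for \<open>0 < k\<close>): horizontal
  lines become circles around 0 whose radius shrinks as \<open>Im z\<close> grows, and the real axis
  becomes the unit circle.\<close>

definition wrap :: "nat \<Rightarrow> complex \<Rightarrow> complex" where
  "wrap k z = exp (2 * of_real pi * \<i> * z / of_nat k)"

lemma wrap_eq_iff:
  assumes "0 < k"
  shows "wrap k z = wrap k w \<longleftrightarrow> (\<exists>m::int. z = w + of_int (m * int k))"
proof -
  have "2 * of_real pi * \<i> * z / of_nat k = 2 * of_real pi * \<i> * w / of_nat k + (of_int (2 * m) * of_real pi) * \<i>
      \<longleftrightarrow> z = w + of_int (m * int k)" for m
  proof -
    have "2 * of_real pi * \<i> * w / of_nat k + (of_int (2 * m) * of_real pi) * \<i>
        = 2 * of_real pi * \<i> * (w + of_int (m * int k)) / of_nat k"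
      using assms by (simp add: field_simps)
    moreover have "2 * of_real pi * \<i> * x / of_nat k = 2 * of_real pi * \<i> * y / of_nat k \<longleftrightarrow> x = y" for x y :: complex
      using assms by simp
    ultimately show ?thesis by metis
  qed
  then show ?thesis unfolding wrap_def exp_eq by simp
qed

lemma norm_wrap: "norm (wrap k z) = exp (- (2 * pi * Im z / k))"
  by (simp add: wrap_def Re_divide_of_nat)

lemma wrap_surj: "0 < k \<Longrightarrow> w \<noteq> 0 \<Longrightarrow> \<exists>z. w = wrap k z"
  by (rule exI[of _ "Ln w * of_nat k / (2 * of_real pi * \<i>)"]) (simp add: wrap_def)

lemma continuous_on_wrap: "continuous_on S (wrap k)"
  unfolding wrap_def by (cases "k = 0") (auto intro!: continuous_intros)

section \<open>Lattice points, unit steps and open lattice triangles\<close>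

abbreviation lat :: "nat \<Rightarrow> int \<Rightarrow> complex" where
  "lat i j \<equiv> Complex (of_int j) (of_nat i)"

text \<open>The directions of the edges \<open>hE\<close>, \<open>vE\<close> and \<open>dE\<close>,
  in this order.\<close>

definition unit_steps :: "complex set" where
  "unit_steps = {1, \<i>, 1 + \<i>}"

lemma unit_stepsD:
  assumes "s \<in> unit_steps"
  shows "Re s \<in> {0, 1}" "Im s \<in> {0, 1}" "s \<noteq> 0"
  using assms by (auto simp: unit_steps_def complex_eq_iff)

lemma open_step_in_unit:
  assumes "s \<in> unit_steps" "0 < t" "t < 1"
  shows "0 \<le> t * Re s" "t * Re s < 1" "0 \<le> t * Im s" "t * Im s < 1"
  using assms by (auto simp: unit_steps_def)

lemma open_step_not_lattice:
  assumes "s \<in> unit_steps" "0 < t" "t < 1"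
  shows "lat i j + of_real t * s \<noteq> lat i' j'"
proof
  assume eq: "lat i j + of_real t * s = lat i' j'"
  have "of_int j + t * Re s = of_int j' + 0" "of_int (int i) + t * Im s = of_int (int i') + 0"
    using eq by (simp_all add: complex_eq_iff)
  then have "t * Re s = 0 \<and> t * Im s = 0"
    using of_int_add_frac_eq open_step_in_unit[OF assms] by (metis order_refl zero_less_one)
  then have "s = 0" using assms by (simp add: complex_eq_iff)
  then show False using unit_stepsD(3) assms by blast
qed

text \<open>An open step stays in the half-open unit square at its start, so integer parts recover
  the start; the fractional parts \<open>(t, 0)\<close>, \<open>(0, t)\<close> or
  \<open>(t, t)\<close> recover the direction.\<close>

lemma open_step_eq:
  assumes "s \<in> unit_steps" "0 < t" "t < 1" "s' \<in> unit_steps" "0 < t'" "t' < 1"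
    and eq: "lat i j + of_real t * s = lat i' j' + of_real t' * s'"
  shows "i = i' \<and> j = j' \<and> s = s'"
proof -
  have "of_int j + t * Re s = of_int j' + t' * Re s'"
       "of_int (int i) + t * Im s = of_int (int i') + t' * Im s'"
    using eq by (simp_all add: complex_eq_iff)
  then have *: "j = j' \<and> t * Re s = t' * Re s'" "int i = int i' \<and> t * Im s = t' * Im s'"
    using of_int_add_frac_eq open_step_in_unit assms(1-6) by metis+
  have "Re s = Re s'" "Im s = Im s'"
    using * unit_stepsD[OF assms(1)] unit_stepsD[OF assms(4)] assms(2,5) by auto
  then show ?thesis using * by (simp add: complex_eq_iff)
qed

lemma in_closed_segment_step:
  "x \<in> closed_segment z (z + s) \<longleftrightarrow> (\<exists>t. 0 \<le> t \<and> t \<le> 1 \<and> x = z + of_real t * s)" for x z s :: complex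
proof -
  have "(1 - t) *\<^sub>R z + t *\<^sub>R (z + s) = z + of_real t * s" for t
    by (simp add: scaleR_conv_of_real algebra_simps)
  then show ?thesis unfolding closed_segment_def by auto
qed

text \<open>A half of the unit square at \<open>lat i j\<close>: \<open>c = 0\<close> is under the
  diagonal, \<open>c = 1\<close> above it. Each of \<open>Re z\<close>, \<open>Im z\<close> and
  \<open>Re z - Im z\<close> lies strictly between consecutive integers, so three floors identify
  the triangle.\<close>

definition tri :: "nat \<Rightarrow> int \<Rightarrow> int \<Rightarrow> complex set" where
  "tri i j c = {z. of_int j < Re z \<and> Re z < of_int j + 1 \<and> of_nat i < Im z \<and> Im z < of_nat i + 1 \<and>
     of_int (j - int i - c) < Re z - Im z \<and> Re z - Im z < of_int (j - int i - c) + 1}"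

lemma convex_tri: "convex (tri i j c)"
proof -
  have eq: "tri i j c = {z. of_int j < 1 \<bullet> z} \<inter> {z. 1 \<bullet> z < of_int j + 1} \<inter> {z. of_nat i < \<i> \<bullet> z} \<inter>
     {z. \<i> \<bullet> z < of_nat i + 1} \<inter> {z. of_int (j - int i - c) < (1 - \<i>) \<bullet> z} \<inter>
     {z. (1 - \<i>) \<bullet> z < of_int (j - int i - c) + 1}"
    by (auto simp: tri_def inner_complex_def)
  have gt: "convex {z. a < v \<bullet> z}" for a and v :: complex
    using convex_halfspace_gt[where a = v and b = a] by simp
  show ?thesis unfolding eq by (intro convex_Int gt convex_halfspace_lt)
qed

lemma open_tri: "open (tri i j c)"
  unfolding tri_def by (intro open_Collect_conj open_Collect_less continuous_intros)

lemma tri_nonempty: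
  assumes "c \<in> {0, 1}"
  shows "tri i j c \<noteq> {}"
proof (cases "c = 0")
  case True
  then have "Complex (of_int j + 2 / 3) (of_nat i + 1 / 3) \<in> tri i j c" by (simp add: tri_def)
  then show ?thesis by blast
next
  case False
  then have "Complex (of_int j + 1 / 3) (of_nat i + 2 / 3) \<in> tri i j c" using assms by (simp add: tri_def)
  then show ?thesis by blast
qed

lemma tri_floor:
  assumes "z \<in> tri i j c"
  shows "\<lfloor>Re z\<rfloor> = j" "\<lfloor>Im z\<rfloor> = int i" "\<lfloor>Re z - Im z\<rfloor> = j - int i - c"
  using assms by (auto simp: tri_def floor_eq_iff)

lemma cylinder_grid_wrap:
  assumes "3 \<le> k" "2 \<le> l"
  shows "cylinder_grid k l (\<lambda>i j. wrap k (lat i j))"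
proof
  fix i i' j j'
  have "lat i j = lat i' j' + of_int (m * int k) \<longleftrightarrow> i = i' \<and> j - j' = m * int k" for m
  proof -
    have "real_of_int j = of_int j' + of_int m * of_nat k \<longleftrightarrow> real_of_int j = of_int (j' + m * int k)" by simp
    also have "\<dots> \<longleftrightarrow> j - j' = m * int k" unfolding of_int_eq_iff by auto
    finally show ?thesis by (auto simp: complex_eq_iff)
  qed
  then show "wrap k (lat i j) = wrap k (lat i' j') \<longleftrightarrow> i = i' \<and> int k dvd j - j'"
    using assms by (simp add: wrap_eq_iff dvd_def mult.commute)
qed (use assms in auto)

section \<open>The drawing by wrapped lattice steps, and its planarity\<close>

locale cylinder_drawing = cylinder_grid k l "\<lambda>i j. wrap k (lat i j)" for k l :: nat
begin

lemma k_pos: "0 < k"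
  using k3 by simp

lemma wrap_iff: "wrap k z = wrap k w \<longleftrightarrow> (\<exists>m::int. z = w + of_int (m * int k))"
  by (rule wrap_eq_iff[OF k_pos])

lemma lat_add_period: "lat i j + of_int (m * int k) = lat i (j + m * int k)"
  by (simp add: complex_eq_iff)

definition stepE :: "nat \<Rightarrow> int \<Rightarrow> complex \<Rightarrow> complex set" where
  "stepE i j s = {wrap k (lat i j), wrap k (lat i j + s)}"

text \<open>An edge is given only as a set of two vertices, so all its lattice representations are
  collected. They differ by whole periods and have the same wrapped segment, so for an edge of
  \<open>G\<close> the union is a single arc.\<close>

definition draw :: "complex set \<Rightarrow> complex set" where
  "draw e = \<Union>{wrap k ` closed_segment (lat i j) (lat i j + s) | i j s. s \<in> unit_steps \<and> e = stepE i j s}"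

lemma stepE_eqs: "stepE i j 1 = hE i j" "stepE i j \<i> = vE i j" "stepE i j (1 + \<i>) = dE i j"
proof -
  have "lat i j + 1 = lat i (j + 1)" "lat i j + \<i> = lat (Suc i) j" "lat i j + (1 + \<i>) = lat (Suc i) (j + 1)"
    by (simp_all add: complex_eq_iff)
  then show "stepE i j 1 = hE i j" "stepE i j \<i> = vE i j" "stepE i j (1 + \<i>) = dE i j"
    by (simp_all only: stepE_def hE_def vE_def dE_def)
qed

lemma stepE_inj:
  assumes "s \<in> unit_steps" "s' \<in> unit_steps" "stepE i j s = stepE i' j' s'"
  shows "i = i' \<and> s = s' \<and> int k dvd j - j'"
  using assms by (auto simp: unit_steps_def stepE_eqs edge_simps)

lemma wrap_segment_period:
  assumes "int k dvd j - j'"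
  shows "wrap k ` closed_segment (lat i j) (lat i j + s) = wrap k ` closed_segment (lat i j') (lat i j' + s)"
proof -
  obtain m where "j = j' + m * int k" using assms by (auto simp: dvd_def algebra_simps)
  then have eq: "lat i j = of_int (m * int k) + lat i j'"
    using lat_add_period[where i = i and j = j' and m = m] by (simp add: add.commute)
  have w: "wrap k (of_int (m * int k) + x) = wrap k x" for x
    unfolding wrap_iff by (rule exI[of _ m]) simp
  show ?thesis unfolding eq add.assoc closed_segment_translation image_image w ..
qed

lemma draw_stepE:
  assumes "s \<in> unit_steps"
  shows "draw (stepE i j s) = wrap k ` closed_segment (lat i j) (lat i j + s)"
proof -
  have "{wrap k ` closed_segment (lat i' j') (lat i' j' + s') | i' j' s'. s' \<in> unit_steps \<and> stepE i j s = stepE i' j' s'}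
     = {wrap k ` closed_segment (lat i j) (lat i j + s)}" (is "?L = {?S}")
  proof
    show "?L \<subseteq> {?S}"
    proof
      fix x assume "x \<in> ?L"
      then obtain i' j' s' where x: "x = wrap k ` closed_segment (lat i' j') (lat i' j' + s')"
        and s': "s' \<in> unit_steps" "stepE i j s = stepE i' j' s'" by blast
      then have "i = i'" "s = s'" "int k dvd j - j'" using stepE_inj[OF assms s'] by auto
      then show "x \<in> {?S}" using x wrap_segment_period by auto
    qed
    show "{?S} \<subseteq> ?L" using assms by blast
  qed
  then show ?thesis unfolding draw_def by simp
qed

lemma edges_G_stepE:
  "e \<in> edges G \<longleftrightarrow> (\<exists>i j s. s \<in> unit_steps \<and> i < l \<and> (s = 1 \<or> Suc i < l) \<and> e = stepE i j s)"
proof -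
  have "e \<in> edges G \<longleftrightarrow> (\<exists>i j. i < l \<and> (e = stepE i j 1 \<or> Suc i < l \<and> (e = stepE i j \<i> \<or> e = stepE i j (1 + \<i>))))"
    unfolding stepE_eqs G_def horizontal_def slanted_def snd_conv Un_iff mem_Collect_eq
    using Suc_lessD by blast
  moreover have "1 \<in> unit_steps" "\<i> \<in> unit_steps" "1 + \<i> \<in> unit_steps" "\<i> \<noteq> 1" "1 + \<i> \<noteq> 1"
      "\<And>s. s \<in> unit_steps \<Longrightarrow> s = 1 \<or> s = \<i> \<or> s = 1 + \<i>"
    by (auto simp: unit_steps_def complex_eq_iff)
  ultimately show ?thesis by metis
qed

lemma edge_stepE:
  assumes "e \<in> edges G"
  obtains i j s where "s \<in> unit_steps" "i < l" "s = 1 \<or> Suc i < l" "e = stepE i j s"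
    "draw e = wrap k ` closed_segment (lat i j) (lat i j + s)"
  using assms draw_stepE unfolding edges_G_stepE by metis

lemma step_lat: "s \<in> unit_steps \<Longrightarrow> \<exists>i' j'. lat i j + s = lat i' j'"
proof -
  assume s: "s \<in> unit_steps"
  have "lat i j + 1 = lat i (j + 1)" "lat i j + \<i> = lat (Suc i) j" "lat i j + (1 + \<i>) = lat (Suc i) (j + 1)"
    by (simp_all add: complex_eq_iff)
  then show ?thesis using s unfolding unit_steps_def by blast
qed

lemma open_step_not_vertex:
  assumes "s \<in> unit_steps" "0 < t" "t < 1"
  shows "wrap k (lat i j + of_real t * s) \<noteq> wrap k (lat i' j')"
  using open_step_not_lattice[OF assms] unfolding wrap_iff lat_add_period by blast

lemma draw_minus_stepE:
  assumes "s \<in> unit_steps" "x \<in> draw (stepE i j s) - stepE i j s"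
  obtains t where "0 < t" "t < 1" "x = wrap k (lat i j + of_real t * s)"
proof -
  obtain t where t: "0 \<le> t" "t \<le> 1" "x = wrap k (lat i j + of_real t * s)"
    using assms by (auto simp: draw_stepE in_closed_segment_step)
  moreover have "t \<noteq> 0" "t \<noteq> 1" using assms(2) t(3) by (auto simp: stepE_def)
  ultimately show ?thesis using that[of t] by simp
qed

lemma arc_draw:
  assumes s: "s \<in> unit_steps"
  shows "\<exists>g. arc g \<and> path_image g = draw (stepE i j s) \<and> {pathstart g, pathfinish g} = stepE i j s"
proof -
  let ?z = "lat i j"
  let ?g = "wrap k \<circ> linepath ?z (?z + s)"
  have lp: "linepath ?z (?z + s) t = ?z + of_real t * s" for t
    by (simp add: linepath_def scaleR_conv_of_real algebra_simps)
  have "path ?g" by (intro path_continuous_image continuous_on_wrap) simp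
  moreover have "inj_on ?g {0..1}"
  proof (rule inj_onI)
    fix t t' :: real assume t: "t \<in> {0..1}" "t' \<in> {0..1}" and "?g t = ?g t'"
    then obtain m :: int where "?z + of_real t * s = ?z + of_real t' * s + of_int (m * int k)"
      unfolding o_def lp wrap_iff by blast
    then have *: "t * Re s = t' * Re s + of_int (m * int k)" "t * Im s = t' * Im s"
      by (auto simp: complex_eq_iff)
    show "t = t'"
    \<comment> \<open>Off a row the height determines the parameter. Along a row the two points are
      at distance at most 1, while a nonzero multiple of the period is at least 3.\<close>
    proof (cases "Im s = 0")
      case True
      then have "Re s = 1" using unit_stepsD[OF s] by (auto simp: complex_eq_iff)
      then have "real_of_int (m * int k) = t - t'" using * by simp
      then have "\<bar>real_of_int (m * int k)\<bar> \<le> 1" using t by auto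
      then have "\<bar>m * int k\<bar> \<le> 1" by linarith
      then have "m * int k = 0" using int_dvd_small_imp_zero[of k "m * int k"] k3 by simp
      then show ?thesis using * \<open>Re s = 1\<close> by simp
    qed (use * in simp)
  qed
  ultimately have "arc ?g" by (simp add: arc_def)
  moreover have "path_image ?g = draw (stepE i j s)"
    by (simp add: path_image_compose draw_stepE[OF s])
  moreover have "{pathstart ?g, pathfinish ?g} = stepE i j s"
    by (simp add: pathstart_compose pathfinish_compose stepE_def)
  ultimately show ?thesis by blast
qed

lemma plane_graph_G: "plane_graph G draw"
  unfolding plane_graph_def
proof (intro conjI ballI impI)
  show "simple_graph G" by (rule simple_graph_G)
  show "\<exists>g. arc g \<and> path_image g = draw e \<and> {pathstart g, pathfinish g} = e" if "e \<in> edges G" for e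
    using that arc_draw unfolding edges_G_stepE by blast
  show "(draw e - e) \<inter> verts G = {}" if eG: "e \<in> edges G" for e
  proof (rule equals0I)
    obtain i j s where s: "s \<in> unit_steps" and e: "e = stepE i j s"
      using eG unfolding edges_G_stepE by blast
    fix x assume x: "x \<in> (draw e - e) \<inter> verts G"
    then obtain t where "0 < t" "t < 1" "x = wrap k (lat i j + of_real t * s)"
      using draw_minus_stepE[OF s] e by blast
    moreover obtain i' j' where "x = wrap k (lat i' j')" using x by (auto simp: G_def V_def)
    ultimately show False using open_step_not_vertex[OF s] by blast
  qed
  show "(draw e - e) \<inter> draw e' = {}" if eG: "e \<in> edges G" "e' \<in> edges G" "e \<noteq> e'" for e e'
  proof (rule equals0I)
    obtain i j s where s: "s \<in> unit_steps" and e: "e = stepE i j s"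
      using eG unfolding edges_G_stepE by blast
    obtain i' j' s' where s': "s' \<in> unit_steps" and e': "e' = stepE i' j' s'"
      using eG unfolding edges_G_stepE by blast
    fix x assume x: "x \<in> (draw e - e) \<inter> draw e'"
    then obtain t where t: "0 < t" "t < 1" "x = wrap k (lat i j + of_real t * s)"
      using draw_minus_stepE[OF s] e by blast
    \<comment> \<open>The ends of \<open>e'\<close> are wrapped lattice points, so a common point is
      interior to both edges.\<close>
    have "x \<notin> e'"
    proof
      assume "x \<in> e'"
      then obtain i'' j'' where "x = wrap k (lat i'' j'')"
        using step_lat[OF s'] unfolding e' stepE_def by (metis insertE singletonD)
      then show False using open_step_not_vertex[OF s t(1,2)] t(3) by metis
    qed
    then obtain t' where t': "0 < t'" "t' < 1" "x = wrap k (lat i' j' + of_real t' * s')"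
      using draw_minus_stepE[OF s'] e' x by blast
    then have "wrap k (lat i j + of_real t * s) = wrap k (lat i' j' + of_real t' * s')"
      using t(3) by simp
    then obtain m where "lat i j + of_real t * s = lat i' j' + of_real t' * s' + of_int (m * int k)"
      unfolding wrap_iff by blast
    then have "lat i j + of_real t * s = (lat i' j' + of_int (m * int k)) + of_real t' * s'"
      by (simp add: algebra_simps)
    \<comment> \<open>The period is absorbed into the column index, which leaves two open steps of
      the unwrapped lattice to compare.\<close>
    then have "lat i j + of_real t * s = lat i' (j' + m * int k) + of_real t' * s'"
      unfolding lat_add_period .
    then have *: "i = i'" "j = j' + m * int k" "s = s'"
      using open_step_eq s s' t t' by blast+
    have "lat i' j' + of_int (m * int k) + s' = (lat i' j' + s') + of_int (m * int k)" by simp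
    then have "stepE i j s = stepE i' j' s'"
      unfolding stepE_def * lat_add_period[symmetric] using wrap_iff by (metis (no_types))
    then show False using eG e e' by blast
  qed
qed

text \<open>The lines of the unwrapped drawing. As one set of points, they allow the complement to
  be described by integrality of coordinates instead of edge by edge.\<close>

definition skeleton :: "complex set" where
  "skeleton = {z. 0 \<le> Im z \<and> Im z \<le> of_nat l - 1 \<and> (Re z \<in> \<int> \<or> Im z \<in> \<int> \<or> Re z - Im z \<in> \<int>)}"

lemma drawing_eq_skeleton: "verts G \<union> (\<Union>e\<in>edges G. draw e) = wrap k ` skeleton"
proof
  have "wrap k (lat i j) \<in> wrap k ` skeleton" if "i < l" for i j
    using that by (intro imageI) (simp add: skeleton_def)
  then have "verts G \<subseteq> wrap k ` skeleton" by (auto simp: G_def V_def)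
  moreover have "draw e \<subseteq> wrap k ` skeleton" if e: "e \<in> edges G" for e
  proof -
    obtain i j s where s: "s \<in> unit_steps" "i < l" "s = 1 \<or> Suc i < l"
      and d: "draw e = wrap k ` closed_segment (lat i j) (lat i j + s)"
      using edge_stepE[OF e] by metis
    have "lat i j + of_real t * s \<in> skeleton" if t: "0 \<le> t" "t \<le> 1" for t
    proof -
      have "real i + t * Im s \<le> of_nat l - 1"
        using s t by (auto simp: unit_steps_def)
      moreover have "0 \<le> real i + t * Im s" using unit_stepsD(2)[OF s(1)] t by auto
      moreover have "of_int j + t * Re s \<in> \<int> \<or> real i + t * Im s \<in> \<int> \<or>
          (of_int j + t * Re s) - (real i + t * Im s) \<in> \<int>"
        using s(1) by (auto simp: unit_steps_def)
      ultimately show ?thesis by (simp add: skeleton_def)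
    qed
    then show ?thesis unfolding d by (auto simp: in_closed_segment_step)
  qed
  ultimately show "verts G \<union> (\<Union>e\<in>edges G. draw e) \<subseteq> wrap k ` skeleton" by blast
next
  have "wrap k z \<in> (\<Union>e\<in>edges G. draw e)" if z: "z \<in> skeleton" for z
  proof -
    define i j where "i = nat \<lfloor>Im z\<rfloor>" and "j = \<lfloor>Re z\<rfloor>"
    define u t where "u = frac (Re z)" and "t = frac (Im z)"
    have i: "real i = of_int \<lfloor>Im z\<rfloor>" using z by (simp add: i_def skeleton_def)
    have re: "Re z = of_int j + u" and im: "Im z = real i + t"
      unfolding i by (simp_all add: j_def u_def t_def frac_def)
    have ut: "0 \<le> u" "u < 1" "0 \<le> t" "t < 1" by (simp_all add: u_def t_def frac_lt_1)
    have le: "real i + t \<le> of_nat l - 1" using z im by (simp add: skeleton_def)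
    then have il: "i < l" using ut by linarith
    \<comment> \<open>On the last row only \<open>t = 0\<close> is possible, so a point with
      \<open>0 < t\<close> has a further row above it.\<close>
    have sil: "Suc i < l" if "0 < t" using le that by linarith
    \<comment> \<open>If \<open>t = 0\<close>, the point lies on a row edge; otherwise
      \<open>u = 0\<close> puts it on an edge \<open>vE\<close>, and the remaining case
      \<open>u = t\<close> on a diagonal.\<close>
    have "\<exists>s r. s \<in> unit_steps \<and> (s = 1 \<or> Suc i < l) \<and> 0 \<le> r \<and> r \<le> 1 \<and> z = lat i j + of_real r * s"
    proof (cases "t = 0")
      case True
      then have "z = lat i j + of_real u * 1" using re im by (simp add: complex_eq_iff)
      then show ?thesis using ut by (intro exI[of _ 1] exI[of _ u]) (auto simp: unit_steps_def)
    next
      case False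
      then have t0: "0 < t" and ni: "Im z \<notin> \<int>" using ut by (auto simp: t_def frac_eq_0_iff)
      show ?thesis
      proof (cases "u = 0")
        case True
        then have "z = lat i j + of_real t * \<i>" using re im by (simp add: complex_eq_iff)
        then show ?thesis using ut sil[OF t0] by (intro exI[of _ \<i>] exI[of _ t]) (auto simp: unit_steps_def)
      next
        case False
        then have "Re z \<notin> \<int>" by (simp add: u_def frac_eq_0_iff)
        then have "Re z - Im z \<in> \<int>" using z ni by (simp add: skeleton_def)
        then obtain n :: int where "Re z - Im z = of_int n" by (auto elim: Ints_cases)
        then have "of_int j + u = of_int (int i + n) + t" using re im by simp
        then have "u = t" using of_int_add_frac_eq ut by blast
        then have "z = lat i j + of_real t * (1 + \<i>)" using re im by (simp add: complex_eq_iff)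
        then show ?thesis using ut sil[OF t0] by (intro exI[of _ "1 + \<i>"] exI[of _ t]) (auto simp: unit_steps_def)
      qed
    qed
    then obtain s r where s: "s \<in> unit_steps" "s = 1 \<or> Suc i < l"
      and "0 \<le> r" "r \<le> 1" "z = lat i j + of_real r * s" by blast
    then have "z \<in> closed_segment (lat i j) (lat i j + s)" by (auto simp: in_closed_segment_step)
    then have "wrap k z \<in> draw (stepE i j s)" using draw_stepE s by blast
    moreover have "stepE i j s \<in> edges G" unfolding edges_G_stepE using s il by blast
    ultimately show ?thesis by blast
  qed
  then show "wrap k ` skeleton \<subseteq> verts G \<union> (\<Union>e\<in>edges G. draw e)" by blast
qed

end

section \<open>Faces\<close>

context cylinder_drawing
begin

text \<open>The radius is that of the innermost circle, which is row \<open>l - 1\<close>; row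
  \<open>0\<close> is the unit circle and bounds \<open>outer_face\<close>.\<close>

definition inner_face :: "complex set" where
  "inner_face = ball 0 (exp (- (2 * pi * (of_nat l - 1) / k)))"

definition outer_face :: "complex set" where
  "outer_face = - cball 0 1"

definition tri_index :: "(nat \<times> int \<times> int) set" where
  "tri_index = {..<l - 1} \<times> {0..<int k} \<times> {0, 1}"

definition tri_face :: "nat \<times> int \<times> int \<Rightarrow> complex set" where
  "tri_face = (\<lambda>(i, j, c). wrap k ` tri i j c)"

lemma wrap_in_inner: "wrap k z \<in> inner_face \<longleftrightarrow> of_nat l - 1 < Im z"
  using k_pos by (simp add: inner_face_def norm_wrap divide_less_cancel)

lemma wrap_in_outer: "wrap k z \<in> outer_face \<longleftrightarrow> Im z < 0"
  using k_pos by (simp add: outer_face_def norm_wrap not_le divide_less_0_iff mult_less_0_iff)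

lemma tri_Im:
  assumes "z \<in> tri i j c" "i < l - 1"
  shows "0 < Im z" "Im z < of_nat l - 1"
  using assms by (auto simp: tri_def)

text \<open>Equal wrapped points differ by a multiple of \<open>k\<close> in the real part, which
  shifts two of the three floors equally. Both columns lie in one period, so the shift is 0.\<close>

lemma tri_face_inj:
  assumes "z \<in> tri i j c" "z' \<in> tri i' j' c'" "wrap k z = wrap k z'"
    and "(i, j, c) \<in> tri_index" "(i', j', c') \<in> tri_index"
  shows "(i, j, c) = (i', j', c')"
proof -
  obtain m where "z = z' + of_int (m * int k)" using assms(3) unfolding wrap_iff by blast
  then have z: "Re z = Re z' + of_int (m * int k)" "Im z = Im z'" by simp_all
  then have "\<lfloor>Re z\<rfloor> = \<lfloor>Re z'\<rfloor> + m * int k" "\<lfloor>Re z - Im z\<rfloor> = \<lfloor>Re z' - Im z'\<rfloor> + m * int k"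
    using floor_add_int[of "Re z'" "m * int k"] floor_add_int[of "Re z' - Im z'" "m * int k"]
    by (simp_all add: algebra_simps)
  then have *: "j = j' + m * int k" "i = i'" "j - int i - c = j' - int i' - c' + m * int k"
    using tri_floor[OF assms(1)] tri_floor[OF assms(2)] z by simp_all
  then have "int k dvd j - j'" by simp
  then have "j = j'" using assms(4,5) residue_eq_iff by (auto simp: tri_index_def)
  then show ?thesis using * by simp
qed

text \<open>The triangle is narrower than a period. Injectivity makes its image open, by invariance
  of domain.\<close>

lemma inj_on_wrap_tri: "inj_on (wrap k) (tri i j c)"
proof (rule inj_onI)
  fix z z' assume z: "z \<in> tri i j c" "z' \<in> tri i j c" "wrap k z = wrap k z'"
  then obtain m where m: "z = z' + of_int (m * int k)" unfolding wrap_iff by blast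
  then have "\<lfloor>Re z\<rfloor> = \<lfloor>Re z'\<rfloor> + m * int k" using floor_add_int[of "Re z'" "m * int k"] by simp
  then have "m * int k = 0" using tri_floor(1)[OF z(1)] tri_floor(1)[OF z(2)] by simp
  then show "z = z'" using m by simp
qed

lemma tri_face_props:
  assumes "x \<in> tri_index"
  shows "open (tri_face x)" "connected (tri_face x)" "tri_face x \<noteq> {}"
proof -
  obtain i j c where x: "x = (i, j, c)" "c \<in> {0, 1}" using assms by (auto simp: tri_index_def)
  show "open (tri_face x)"
    using invariance_of_domain[OF continuous_on_wrap open_tri inj_on_wrap_tri] by (simp add: x tri_face_def)
  show "connected (tri_face x)"
    unfolding x tri_face_def using convex_connected[OF convex_tri]
    by (auto intro: connected_continuous_image continuous_on_wrap)
  show "tri_face x \<noteq> {}" using tri_nonempty x by (simp add: tri_face_def)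
qed

lemma tri_face_disjoint:
  assumes "x \<in> tri_index" "y \<in> tri_index" "x \<noteq> y"
  shows "tri_face x \<inter> tri_face y = {}"
proof (rule equals0I)
  fix w assume w: "w \<in> tri_face x \<inter> tri_face y"
  obtain i j c i' j' c' where xy: "x = (i, j, c)" "y = (i', j', c')" by (metis prod_cases3)
  have "w \<in> wrap k ` tri i j c" "w \<in> wrap k ` tri i' j' c'"
    using w by (simp_all add: xy tri_face_def)
  then obtain z z' where "w = wrap k z" "z \<in> tri i j c" "w = wrap k z'" "z' \<in> tri i' j' c'"
    by blast
  then show False using tri_face_inj[of z i j c z' i' j' c'] assms by (simp add: xy)
qed

lemma tri_face_disjoint_ends:
  assumes "x \<in> tri_index"
  shows "tri_face x \<inter> inner_face = {}" "tri_face x \<inter> outer_face = {}"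
proof -
  obtain i j c where x: "x = (i, j, c)" "i < l - 1" using assms by (auto simp: tri_index_def)
  show "tri_face x \<inter> inner_face = {}"
    using tri_Im(2)[OF _ x(2)] by (force simp: x tri_face_def wrap_in_inner)
  show "tri_face x \<inter> outer_face = {}"
    using tri_Im(1)[OF _ x(2)] by (force simp: x tri_face_def wrap_in_outer)
qed

lemma inner_outer:
  "open inner_face" "connected inner_face" "inner_face \<noteq> {}"
  "open outer_face" "connected outer_face" "outer_face \<noteq> {}"
  "inner_face \<inter> outer_face = {}"
proof -
  show "open inner_face" "connected inner_face" "inner_face \<noteq> {}"
    by (simp_all add: inner_face_def convex_connected)
  show "open outer_face" by (simp add: outer_face_def open_Compl)
  show "connected outer_face"
    unfolding outer_face_def by (rule connected_complement_bounded_convex) auto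
  have "(2::complex) \<in> outer_face" by (simp add: outer_face_def)
  then show "outer_face \<noteq> {}" by blast
  have "exp (- (2 * pi * (of_nat l - 1) / k)) \<le> 1" using l2 by simp
  then have "inner_face \<subseteq> cball 0 1"
    unfolding inner_face_def by (meson ball_subset_cball order_trans subset_cball)
  then show "inner_face \<inter> outer_face = {}" unfolding outer_face_def by blast
qed

definition all_faces :: "complex set set" where
  "all_faces = insert inner_face (insert outer_face (tri_face ` tri_index))"

lemma in_tri_if_not_skeleton:
  assumes "0 \<le> Im z" "Im z \<le> of_nat l - 1" "z \<notin> skeleton"
  shows "\<exists>x\<in>tri_index. wrap k z \<in> tri_face x"
proof -
  \<comment> \<open>Subtracting \<open>m\<close> whole periods moves the column index into
    \<open>{0..<int k}\<close> without changing the wrapped point.\<close>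
  define m where "m = \<lfloor>Re z\<rfloor> div int k"
  define y where "y = z - of_int (m * int k)"
  have "z = y + of_int (m * int k)" by (simp add: y_def)
  then have wy: "wrap k z = wrap k y" unfolding wrap_iff by blast
  have imy: "Im y = Im z" by (simp add: y_def)
  define i j where "i = nat \<lfloor>Im z\<rfloor>" and "j = \<lfloor>Re y\<rfloor>"
  define u t where "u = frac (Re y)" and "t = frac (Im z)"
  have i: "real i = of_int \<lfloor>Im z\<rfloor>" using assms(1) by (simp add: i_def)
  have re: "Re y = of_int j + u" and im: "Im z = real i + t"
    unfolding i by (simp_all add: j_def u_def t_def frac_def)
  have nz: "Re z \<notin> \<int>" "Im z \<notin> \<int>" "Re z - Im z \<notin> \<int>" using assms by (auto simp: skeleton_def)
  have rz: "Re z = of_int (m * int k + j) + u" using re by (simp add: y_def)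
  have "u \<noteq> 0"
  proof
    assume "u = 0"
    then have "Re z = of_int (m * int k + j)" using rz by simp
    then show False using nz(1) by (metis Ints_of_int)
  qed
  moreover have "t \<noteq> 0" using nz(2) by (simp add: t_def frac_eq_0_iff)
  moreover have "u \<noteq> t"
  proof
    assume "u = t"
    then have "Re z - Im z = of_int (m * int k + j - int i)" using rz im by simp
    then show False using nz(3) by (metis Ints_of_int)
  qed
  moreover have "0 \<le> u" "u < 1" "0 \<le> t" "t < 1"
    by (simp_all add: u_def t_def frac_lt_1)
  ultimately have ut: "0 < u" "u < 1" "0 < t" "t < 1" "u \<noteq> t" by auto
  have "j = \<lfloor>Re z\<rfloor> - m * int k"
    using floor_diff_of_int[of "Re z" "m * int k"] by (simp add: j_def y_def)
  then have "j = \<lfloor>Re z\<rfloor> mod int k" by (simp add: m_def minus_div_mult_eq_mod)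
  then have j: "j \<in> {0..<int k}" using mod_k_bounds by simp
  have il: "i < l - 1" using im assms(2) ut by linarith
  \<comment> \<open>Off the skeleton \<open>u \<noteq> t\<close>, so comparing the fractional parts
    tells the side of the diagonal.\<close>
  define c :: int where "c = (if t < u then 0 else 1)"
  have "y \<in> tri i j c" using ut re im imy by (auto simp: tri_def c_def)
  moreover have "(i, j, c) \<in> tri_index" using il j by (auto simp: tri_index_def c_def)
  ultimately show ?thesis
    unfolding wy by (intro bexI[of _ "(i, j, c)"]) (auto simp: tri_face_def)
qed

lemma complement_eq_Union_faces: "- (wrap k ` skeleton) = \<Union>all_faces"
proof
  show "- (wrap k ` skeleton) \<subseteq> \<Union>all_faces"
  proof
    fix w assume w: "w \<in> - (wrap k ` skeleton)"
    show "w \<in> \<Union>all_faces"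
    \<comment> \<open>The exponential misses only 0, which is the centre of the inner face.\<close>
    proof (cases "w = 0")
      case True
      then show ?thesis by (simp add: all_faces_def inner_face_def)
    next
      case False
      then obtain z where z: "w = wrap k z" using wrap_surj k_pos by blast
      then have "z \<notin> skeleton" using w by blast
      then consider "Im z < 0" | "of_nat l - 1 < Im z" | x where "x \<in> tri_index" "w \<in> tri_face x"
        using in_tri_if_not_skeleton[of z] z by force
      then show ?thesis
      proof cases
        case 1
        then show ?thesis using wrap_in_outer z by (simp add: all_faces_def)
      next
        case 2
        then show ?thesis using wrap_in_inner z by (simp add: all_faces_def)
      next
        case 3
        then show ?thesis by (auto simp: all_faces_def)
      qed
    qed
  qed
  have "w \<notin> wrap k ` skeleton" if wx: "w \<in> tri_face x" "x \<in> tri_index" for w x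
  proof
    assume "w \<in> wrap k ` skeleton"
    then obtain z' where z': "w = wrap k z'" "z' \<in> skeleton" by blast
    obtain i j c where x: "x = (i, j, c)" by (metis prod_cases3)
    then obtain z where z: "w = wrap k z" "z \<in> tri i j c" using wx by (auto simp: tri_face_def)
    then have "wrap k z' = wrap k z" using z' by simp
    then obtain m where "z' = z + of_int (m * int k)" unfolding wrap_iff by blast
    then have zz: "Re z' = Re z + of_int (m * int k)" "Im z' = Im z" by simp_all
    have n: "Re z \<notin> \<int>" "Im z \<notin> \<int>" "Re z - Im z \<notin> \<int>"
      using z(2) not_Ints_between[of j "Re z"] not_Ints_between[of "int i" "Im z"]
        not_Ints_between[of "j - int i - c" "Re z - Im z"] by (simp_all add: tri_def)
    \<comment> \<open>A shift by whole periods preserves integrality, so \<open>z'\<close> is off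
      all lattice lines just as \<open>z\<close> is.\<close>
    have "Re z' - of_int (m * int k) = Re z" "Re z' - Im z' - of_int (m * int k) = Re z - Im z"
      using zz by simp_all
    then have "Re z' \<notin> \<int>" "Re z' - Im z' \<notin> \<int>" using n(1,3) by (metis Ints_diff Ints_of_int)+
    then show False using z'(2) n(2) zz(2) by (simp add: skeleton_def)
  qed
  moreover have "w \<notin> wrap k ` skeleton" if wx: "w \<in> inner_face \<union> outer_face" for w
  proof
    assume "w \<in> wrap k ` skeleton"
    then obtain z where "w = wrap k z" "z \<in> skeleton" by blast
    then show False using wx wrap_in_inner[of z] wrap_in_outer[of z] by (auto simp: skeleton_def)
  qed
  ultimately show "\<Union>all_faces \<subseteq> - (wrap k ` skeleton)" unfolding all_faces_def by blast
qed

lemma faces_G: "faces G draw = all_faces"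
proof -
  have "components (\<Union>all_faces) = all_faces"
  proof (rule components_Union_disjoint_open)
    show "open S \<and> connected S \<and> S \<noteq> {}" if "S \<in> all_faces" for S
      using that inner_outer tri_face_props by (auto simp: all_faces_def)
    have tri: "tri_face x \<inter> T = {}" if "x \<in> tri_index" "T \<in> all_faces" "tri_face x \<noteq> T" for x T
      using that tri_face_disjoint tri_face_disjoint_ends unfolding all_faces_def by blast
    show "S \<inter> T = {}" if ST: "S \<in> all_faces" "T \<in> all_faces" "S \<noteq> T" for S T
    proof (cases "S \<in> tri_face ` tri_index \<or> T \<in> tri_face ` tri_index")
      case True
      then show ?thesis using tri ST by blast
    next
      case False
      then show ?thesis using ST inner_outer(7) unfolding all_faces_def by blast
    qed
  qed
  then show ?thesis
    unfolding faces_def drawing_eq_skeleton complement_eq_Union_faces .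
qed

lemma card_faces_G: "card (faces G draw) = 2 * k * (l - 1) + 2"
proof -
  \<comment> \<open>Disjoint nonempty sets are different, so the faces can be counted by their
    indices.\<close>
  have "inj_on tri_face tri_index"
    using tri_face_disjoint tri_face_props(3) by (metis inf.idem inj_onI)
  then have "card (tri_face ` tri_index) = card tri_index" by (rule card_image)
  also have "\<dots> = 2 * k * (l - 1)" by (simp add: tri_index_def card_cartesian_product)
  finally have c: "card (tri_face ` tri_index) = 2 * k * (l - 1)" .
  have fin: "finite (tri_face ` tri_index)" by (simp add: tri_index_def)
  have "inner_face \<noteq> outer_face" using inner_outer by auto
  moreover have "inner_face \<notin> tri_face ` tri_index" "outer_face \<notin> tri_face ` tri_index"
    using tri_face_disjoint_ends inner_outer(3,6) by (metis imageE inf.idem)+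
  ultimately show ?thesis
    using c fin by (simp add: faces_G all_faces_def)
qed

end

theorem theorem2:
  fixes k l :: nat
  assumes "k \<ge> 3" and "l \<ge> 2"
  defines "f \<equiv> 2 * k * (l - 1) + 2"
  shows "\<exists>G d. plane_graph G d \<and> graph_connected G \<and> card (faces G d) = f
           \<and> num_cdc G f = l * (l + 1) div 2
           \<and> num_true_cdc G f = 1
           \<and> (if k = 3 \<and> l \<ge> 3 then k_connected 3 G else k_connected 4 G)"
proof -
  interpret cylinder_drawing k l
    unfolding cylinder_drawing_def using assms(1,2) by (rule cylinder_grid_wrap)
  show ?thesis
    unfolding f_def
    using plane_graph_G graph_connected_G card_faces_G num_cdc_G num_true_cdc_G k_connected_G by blast
qed

end
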